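(* Let $P_t(x,\mathrm{d}y)$ denote the restriction to $(0,+\infty)$ of the transition probability of the CB process $(Z_t)_{t\ge0}$ with branching mechanism $\psi$. If $\alpha>0$, then for every $x>0$, $\frac{1}{x\psi(\varphi(t))}P_t(x,\mathrm{d}y)$ converges weakly to $\frac1\alpha\nu_\alpha(\mathrm{d}y)$ as $t\to+\infty$. If $\alpha=0$, then for every $x>0$, $\frac{1}{x\psi(\varphi(t))}P_t(x,\mathrm{d}y)$ converges vaguely to $\mu(\mathrm{d}y)$ as $t\to+\infty$.
   Context: Branching mechanism: $\psi(\lambda)=\alpha\lambda+\frac12\sigma^2\lambda^2+\int_0^{+\infty}(e^{-\lambda r}-1+\lambda r)\,\pi(\mathrm{d}r)$, $\lambda\ge 0$, where $\alpha\ge 0$, $\sigma\ge 0$ and $\pi$ is a positive Radon measure on $(0,+\infty)$ with $\int_0^{+\infty}(r\wedge r^2)\,\pi(\mathrm{d}r)<+\infty$. It is assumed that $\psi(+\infty)=+\infty$ and $\int^{+\infty}\frac{1}{\psi(\lambda)}\,\mathrm{d}\lambda<+\infty$ (integrability at $+\infty$). CB process: $((Z_t)_{t\ge 0},(\mathbb{P}_x)_{x\ge 0})$ is the $[0,+\infty)$-valued right continuous strong Markov process with left limits, absorbed at $0$, with $\mathbb{P}_x(Z_0=x)=1$, and such that the $\mathbb{P}_x$-expectation of $e^{-\lambda Z_t}$ equals $e^{-x u_t(\lambda)}$ for $\lambda>0$, $t\ge 0$, where $\frac{\partial}{\partial t}u_t(\lambda)=-\psi(u_t(\lambda))$, $u_0(\lambda)=\lambda$.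 Thus for Borel $A\subset(0,+\infty)$, $P_t(x,A)=\mathbb{P}_x(Z_t\in A)$. $\phi(\lambda):=\int_\lambda^{+\infty}\frac{1}{\psi(u)}\,\mathrm{d}u$ for $\lambda>0$, which is a strictly decreasing bijection of $(0,+\infty)$, and $\varphi:(0,+\infty)\to(0,+\infty)$ is its inverse function. Scale function: $W$ is the unique strictly increasing, nonnegative, continuous function on $[0,+\infty)$ with $\int_0^{+\infty}e^{-\lambda x}W(x)\,\mathrm{d}x=\frac1{\psi(\lambda)}$ for all $\lambda>0$. The measure $\mu$ on $(0,+\infty)$ is $\mu(\mathrm{d}x)=\frac{W(x)}{x}\,\mathrm{d}x$. When $\alpha>0$, $\nu_\alpha$ (the Yaglom distribution) is the probability measure on $(0,+\infty)$ with $\int_{(0,+\infty)}e^{-\lambda x}\,\nu_\alpha(\mathrm{d}x)=1-e^{-\alpha\phi(\lambda)}$ for all $\lambda>0$. Weak convergence: finite measures $\nu_n$ on $(0,+\infty)$ converge weakly to a finite measure $\nu$ if $\int f\,\mathrm{d}\nu_n\to\int f\,\mathrm{d}\nu$ for all bounded continuous $f$ on $(0,+\infty)$. Vague convergence: measures $\nu_n,\nu$ on $(0,+\infty)$ are extended to $[0,+\infty)$ by giving mass $0$ to $\{0\}$, and $\nu_n$ is said to converge vaguely to $\nu$ if $\int_{[0,+\infty)}g(y)\,\nu_n(\mathrm{d}y)\to\int_{[0,+\infty)}g(y)\,\nu(\mathrm{d}y)$ for all continuous functions $g$ on $[0,+\infty)$ vanishing at infinity.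
   Formalization: Since μ may be infinite, vague convergence is stated for those continuous g vanishing at infinity whose integral against μ exists in [-∞,+∞] (g⁺ or g⁻ is μ-integrable), with integrals taken in the extended reals; for other g the integral is undefined. *)

theory Defs
  imports "HOL-Probability.Probability"
begin

section \<open>Branching mechanism\<close>

definition branching_mech :: "real \<Rightarrow> real \<Rightarrow> real measure \<Rightarrow> real \<Rightarrow> real" where
  "branching_mech \<alpha> \<sigma> \<pi> q =
     \<alpha> * q + \<sigma>\<^sup>2 * q\<^sup>2 / 2 + (\<integral>r. (exp (- q * r) - 1 + q * r) \<partial>\<pi>)"

text \<open>Measures on the open half-line are measures on the subspace \<open>{0<..}\<close> of the real line,
  not measures on the whole line which happen to charge only \<open>{0<..}\<close>. A Borel measure on
  \<open>{0<..}\<close> is Radon iff it is finite on compact sets.\<close>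

locale branching_mechanism =
  fixes \<alpha> \<sigma> :: real and \<pi> :: "real measure"
  assumes alpha_nonneg: "0 \<le> \<alpha>"
    and sigma_nonneg: "0 \<le> \<sigma>"
    and sets_pi: "sets \<pi> = sets (restrict_space borel {0<..})"
    and radon_pi: "\<And>K. compact K \<Longrightarrow> K \<subseteq> {0<..} \<Longrightarrow> emeasure \<pi> K < \<infinity>"
    and moment_pi: "(\<integral>\<^sup>+ r. ennreal (min r (r\<^sup>2)) \<partial>\<pi>) < \<infinity>"
    and mech_at_top: "filterlim (branching_mech \<alpha> \<sigma> \<pi>) at_top at_top"
    and mech_integrable_at_top:
      "\<exists>c>0. set_integrable lborel {c..} (\<lambda>q. 1 / branching_mech \<alpha> \<sigma> \<pi> q)"

text \<open>\<open>ext_time \<psi>\<close> is the decreasing bijection \<open>\<phi>\<close> of \<open>{0<..}\<close>, and \<open>ext_time_inv \<psi>\<close> is its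
  inverse \<open>\<phi>inv\<close>; only their values on \<open>{0<..}\<close> are meaningful. The names come from the law of the
  extinction time, \<open>exp (- x * \<phi>inv t)\<close> being the probability of extinction by time \<open>t\<close>.\<close>

definition ext_time :: "(real \<Rightarrow> real) \<Rightarrow> real \<Rightarrow> real" where
  "ext_time \<psi> q = (LBINT v:{q<..}. 1 / \<psi> v)"

definition ext_time_inv :: "(real \<Rightarrow> real) \<Rightarrow> real \<Rightarrow> real" where
  "ext_time_inv \<psi> = inv_into {0<..} (ext_time \<psi>)"


section \<open>Continuous-state branching process\<close>

text \<open>Time ranges over \<open>ennreal\<close> so that stopping times may be infinite; at \<open>t = \<infinity>\<close> this is
  the \<open>\<sigma>\<close>-algebra generated by the whole process.\<close>

definition natural_filtration ::
  "'w measure \<Rightarrow> (real \<Rightarrow> 'w \<Rightarrow> real) \<Rightarrow> ennreal \<Rightarrow> 'w measure" where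
  "natural_filtration M Z t =
     sigma (space M) {Z s -` B \<inter> space M | s B. 0 \<le> s \<and> ennreal s \<le> t \<and> B \<in> sets borel}"

text \<open>One-dimensional form of the strong Markov property at \<open>T\<close>; it gives the form for the whole
  future process, because \<open>T + s\<close> is again a stopping time.\<close>

definition strong_markov ::
  "'w measure \<Rightarrow> (real \<Rightarrow> 'w measure) \<Rightarrow> (real \<Rightarrow> 'w \<Rightarrow> real) \<Rightarrow> bool" where
  "strong_markov M P Z \<longleftrightarrow>
     (\<forall>T A x s B.
        stopping_time (natural_filtration M Z) T \<longrightarrow>
        A \<in> sets (filtration.pre_sigma (space M) (natural_filtration M Z) T) \<longrightarrow>
        0 \<le> x \<longrightarrow> 0 \<le> s \<longrightarrow> B \<in> sets borel \<longrightarrow>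
          emeasure (P x) {\<omega> \<in> A. T \<omega> < \<infinity> \<and> Z (enn2real (T \<omega>) + s) \<omega> \<in> B} =
          (\<integral>\<^sup>+ \<omega>. emeasure (P (Z (enn2real (T \<omega>)) \<omega>)) {\<omega>' \<in> space M. Z s \<omega>' \<in> B} *
                 indicator {\<omega> \<in> A. T \<omega> < \<infinity>} \<omega> \<partial>P x))"

text \<open>\<open>u t q\<close> is the cumulant semigroup; its nonnegativity is required because the branching
  mechanism is only meaningful on \<open>{0..}\<close>.\<close>

locale cb_process = branching_mechanism \<alpha> \<sigma> \<pi>
  for \<alpha> \<sigma> :: real and \<pi> :: "real measure" +
  fixes M :: "'w measure" and P :: "real \<Rightarrow> 'w measure"
    and Z :: "real \<Rightarrow> 'w \<Rightarrow> real" and u :: "real \<Rightarrow> real \<Rightarrow> real"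
  assumes kernel: "P \<in> restrict_space borel {0..} \<rightarrow>\<^sub>M prob_algebra M"
    and Z_measurable: "\<And>t. 0 \<le> t \<Longrightarrow> Z t \<in> borel_measurable M"
    and Z_nonneg: "\<And>t \<omega>. 0 \<le> t \<Longrightarrow> \<omega> \<in> space M \<Longrightarrow> 0 \<le> Z t \<omega>"
    and Z_right_continuous:
      "\<And>t \<omega>. 0 \<le> t \<Longrightarrow> \<omega> \<in> space M \<Longrightarrow> continuous (at_right t) (\<lambda>s. Z s \<omega>)"
    and Z_left_limits:
      "\<And>t \<omega>. 0 < t \<Longrightarrow> \<omega> \<in> space M \<Longrightarrow> \<exists>l. ((\<lambda>s. Z s \<omega>) \<longlongrightarrow> l) (at_left t)"
    and Z_strong_markov: "strong_markov M P Z"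
    and Z_start: "\<And>x. 0 \<le> x \<Longrightarrow> measure (P x) {\<omega> \<in> space M. Z 0 \<omega> = x} = 1"
    and Z_absorbed: "\<And>x. 0 \<le> x \<Longrightarrow>
      AE \<omega> in P x. \<forall>s t. 0 \<le> s \<longrightarrow> s \<le> t \<longrightarrow> Z s \<omega> = 0 \<longrightarrow> Z t \<omega> = 0"
    and u_nonneg: "\<And>t q. 0 \<le> t \<Longrightarrow> 0 < q \<Longrightarrow> 0 \<le> u t q"
    and u_start: "\<And>q. 0 < q \<Longrightarrow> u 0 q = q"
    and u_ode: "\<And>t q. 0 \<le> t \<Longrightarrow> 0 < q \<Longrightarrow>
      ((\<lambda>s. u s q) has_real_derivative - branching_mech \<alpha> \<sigma> \<pi> (u t q)) (at t within {0..})"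
    and Z_laplace: "\<And>x t q. 0 \<le> x \<Longrightarrow> 0 \<le> t \<Longrightarrow> 0 < q \<Longrightarrow>
      (\<integral>\<omega>. exp (- q * Z t \<omega>) \<partial>P x) = exp (- x * u t q)"

definition trans_pos ::
  "(real \<Rightarrow> 'w measure) \<Rightarrow> (real \<Rightarrow> 'w \<Rightarrow> real) \<Rightarrow> real \<Rightarrow> real \<Rightarrow> real measure" where
  "trans_pos P Z t x = restrict_space (distr (P x) borel (Z t)) {0<..}"


section \<open>Scale function and Yaglom distribution\<close>

definition scale_function :: "(real \<Rightarrow> real) \<Rightarrow> (real \<Rightarrow> real) \<Rightarrow> bool" where
  "scale_function \<psi> W \<longleftrightarrow>
     strict_mono_on {0..} W \<and> (\<forall>x\<ge>0. 0 \<le> W x) \<and> continuous_on {0..} W \<and>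
     (\<forall>q>0. set_integrable lborel {0..} (\<lambda>x. exp (- q * x) * W x) \<and>
            (LBINT x:{0..}. exp (- q * x) * W x) = 1 / \<psi> q)"

definition scale_fun_measure :: "(real \<Rightarrow> real) \<Rightarrow> real measure" where
  "scale_fun_measure W = density (restrict_space lborel {0<..}) (\<lambda>x. ennreal (W x / x))"

definition yaglom_distribution :: "real \<Rightarrow> (real \<Rightarrow> real) \<Rightarrow> real measure \<Rightarrow> bool" where
  "yaglom_distribution \<alpha> \<psi> \<nu> \<longleftrightarrow>
     sets \<nu> = sets (restrict_space borel {0<..}) \<and> prob_space \<nu> \<and>
     (\<forall>q>0. (\<integral>x. exp (- q * x) \<partial>\<nu>) = 1 - exp (- \<alpha> * ext_time \<psi> q))"


section \<open>Weak and vague convergence of measures on the open half-line\<close>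

definition weak_conv_pos :: "('t \<Rightarrow> real measure) \<Rightarrow> real measure \<Rightarrow> 't filter \<Rightarrow> bool" where
  "weak_conv_pos \<nu>s \<nu> F \<longleftrightarrow>
     (\<forall>f :: real \<Rightarrow> real. continuous_on {0<..} f \<longrightarrow> bounded (f ` {0<..}) \<longrightarrow>
        ((\<lambda>t. \<integral>y. f y \<partial>\<nu>s t) \<longlongrightarrow> (\<integral>y. f y \<partial>\<nu>)) F)"

definition extend_zero :: "real measure \<Rightarrow> real measure" where
  "extend_zero \<nu> = distr \<nu> (restrict_space borel {0..}) (\<lambda>y. y)"

text \<open>The limit measure may be infinite even though the test functions only vanish at infinity, so
  the integral of a test function against it may be infinite or undefined. Integrals are therefore
  taken in the extended reals, and a test function is admitted when its positive or its negative
  part has a finite integral against the limit measure. (The Bochner integral would assign the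
  value \<open>0\<close> to every non-integrable function.)\<close>

definition integral_exists :: "real measure \<Rightarrow> (real \<Rightarrow> real) \<Rightarrow> bool" where
  "integral_exists \<nu> g \<longleftrightarrow>
     (\<integral>\<^sup>+ y. ennreal (g y) \<partial>\<nu>) < \<infinity> \<or> (\<integral>\<^sup>+ y. ennreal (- g y) \<partial>\<nu>) < \<infinity>"

definition ereal_integral :: "real measure \<Rightarrow> (real \<Rightarrow> real) \<Rightarrow> ereal" where
  "ereal_integral \<nu> g =
     enn2ereal (\<integral>\<^sup>+ y. ennreal (g y) \<partial>\<nu>) - enn2ereal (\<integral>\<^sup>+ y. ennreal (- g y) \<partial>\<nu>)"

lemma ereal_integral_eq_integral:
  assumes "integrable \<nu> g"
  shows "ereal_integral \<nu> g = ereal (\<integral>y. g y \<partial>\<nu>)"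
proof -
  have "(\<integral>\<^sup>+ y. ennreal (g y) \<partial>\<nu>) < \<infinity>" "(\<integral>\<^sup>+ y. ennreal (- g y) \<partial>\<nu>) < \<infinity>"
    using assms by (auto simp: real_integrable_def less_top)
  then obtain a b where "0 \<le> a" "(\<integral>\<^sup>+ y. ennreal (g y) \<partial>\<nu>) = ennreal a"
    "0 \<le> b" "(\<integral>\<^sup>+ y. ennreal (- g y) \<partial>\<nu>) = ennreal b"
    by (auto simp: less_top_ennreal)
  with real_lebesgue_integral_def[OF assms] show ?thesis
    by (simp add: ereal_integral_def enn2ereal_ennreal)
qed

definition vague_conv_pos :: "('t \<Rightarrow> real measure) \<Rightarrow> real measure \<Rightarrow> 't filter \<Rightarrow> bool" where
  "vague_conv_pos \<nu>s \<nu> F \<longleftrightarrow>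
     (\<forall>g :: real \<Rightarrow> real. continuous_on {0..} g \<longrightarrow> (g \<longlongrightarrow> 0) at_top \<longrightarrow>
        integral_exists (extend_zero \<nu>) g \<longrightarrow>
        ((\<lambda>t. ereal_integral (extend_zero (\<nu>s t)) g)
           \<longlongrightarrow> ereal_integral (extend_zero \<nu>) g) F)"

end

theory Submission
  imports Defs
begin

text \<open>Write \<open>v = phi_inv t\<close>. The process started from \<open>x\<close> is extinct at time \<open>t\<close> with probability
  \<open>exp (- x * v)\<close>, and on survival its Laplace transform is
  \<open>exp (- x * u t q) - exp (- x * v)\<close> with \<open>u t q = phi_inv (t + phi q)\<close>. Since \<open>v\<close> tends to \<open>0\<close>, the
  transform of the rescaled law is governed by \<open>(v - u t q) / mech v\<close>, which tends to
  \<open>discounted_time \<alpha> (phi q)\<close>, the integral of \<open>exp (- \<alpha> * s)\<close> over \<open>0 \<le> s \<le> phi q\<close>. This is the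
  transform of a measure \<open>m\<close>: the Yaglom distribution divided by \<open>\<alpha>\<close> if \<open>\<alpha> > 0\<close>, and \<open>W y / y dy\<close> if
  \<open>\<alpha> = 0\<close>.

  When \<open>\<alpha> = 0\<close> the measure \<open>m\<close> is infinite and a test function may vanish at infinity arbitrarily
  slowly, so convergence of transforms alone does not control the integrals. The missing ingredient
  is an upper bound of the rescaled laws by \<open>m\<close> itself. It rests on two facts.

  \<^item> The measure \<open>m\<close> is quasi-invariant: starting from \<open>m\<close>, the surviving mass at time \<open>t\<close> is distributed
    as \<open>exp (- \<alpha> * t)\<close> times \<open>m\<close> (\<open>quasi_invariant\<close>). On Laplace transforms this is the additivity
    \<open>phi (u t q) = t + phi q\<close>.
  \<^item> By the branching property, \<open>exp (y * v)\<close> times the law at time \<open>t\<close> from \<open>y\<close>, restricted to survival,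
    is superadditive in \<open>y\<close> (\<open>alive_integral_superadditive\<close>): a population may descend from one
    part of its ancestors while the other part dies out. Hence it is at least \<open>y / x - 1\<close> times its
    value at \<open>x\<close>.

  Integrating the second fact against \<open>m\<close> and using the first one bounds the law from \<open>x\<close> by a
  multiple of \<open>m\<close> (\<open>alive_integral_le_limit\<close>). When \<open>\<alpha> = 0\<close> the constant is asymptotically sharp because
  \<open>t * mech v\<close> tends to \<open>0\<close>. When \<open>\<alpha> > 0\<close> it is sharp only for small initial values; there the initial
  value is cut into many small pieces, at the cost of the probability that two pieces survive,
  which is of order \<open>v\<^sup>2\<close> and hence negligible against \<open>mech v\<close>.

  An asymptotic upper bound by \<open>m\<close>, together with convergence on a single positive function, gives
  convergence on all functions below a multiple of it, by applying the bound to the function and to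
  its complement (\<open>tendsto_of_complementary_bounds\<close>); truncation extends this to functions that are
  not dominated. The positive function is \<open>exp (- y)\<close> if \<open>\<alpha> = 0\<close> and the constant \<open>1\<close>
  if \<open>\<alpha> > 0\<close>. This proves convergence of integrals of Borel functions, all nonnegative ones if \<open>\<alpha> = 0\<close>
  and all bounded ones if \<open>\<alpha> > 0\<close>, from which weak and vague convergence are read off.\<close>

section \<open>Uniqueness of the Laplace transform\<close>

text \<open>In the variable \<open>exp (- x)\<close>, which lives in the unit interval, the transform at the integers
  gives the moments, so the Weierstrass approximation theorem applies.\<close>

lemma integral_exp_minus_unique:
  fixes M N :: "real measure" and f :: "real \<Rightarrow> real"
  assumes M: "finite_measure M" "sets M = sets borel" "AE x in M. 0 \<le> x"
    and N: "finite_measure N" "sets N = sets borel" "AE x in N. 0 \<le> x"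
    and eq: "\<And>k::nat. (\<integral>x. exp (- real k * x) \<partial>M) = (\<integral>x. exp (- real k * x) \<partial>N)"
    and f: "continuous_on UNIV f"
  shows "(\<integral>x. f (exp (- x)) \<partial>M) = (\<integral>x. f (exp (- x)) \<partial>N)"
proof -
  have "\<exists>g. real_polynomial_function g \<and> (\<forall>x\<in>{0..1}. \<bar>f x - g x\<bar> < 1 / real (Suc n))" for n
    by (rule Stone_Weierstrass_real_polynomial_function[of "{0..1}" f "1 / real (Suc n)"])
       (use continuous_on_subset[OF f, of "{0..1}"] in \<open>auto simp del: of_nat_Suc\<close>)
  then obtain g where "\<forall>n. real_polynomial_function (g n) \<and> (\<forall>x\<in>{0..1}. \<bar>f x - g n x\<bar> < 1 / real (Suc n))"
    using choice[of "\<lambda>n g. real_polynomial_function g \<and> (\<forall>x\<in>{0..1}. \<bar>f x - g x\<bar> < 1 / real (Suc n))"]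
    by blast
  then have g: "\<And>n. real_polynomial_function (g n)"
    and gf: "\<And>n x. x \<in> {0..1} \<Longrightarrow> \<bar>f x - g n x\<bar> < 1 / real (Suc n)"
    by blast+
  obtain B where B: "\<forall>x\<in>{0..1}. \<bar>f x\<bar> \<le> B"
    using compact_imp_bounded[OF compact_continuous_image[OF continuous_on_subset[OF f], of "{0..1}"]]
    by (auto simp: bounded_iff)
  have g_lim: "(\<lambda>n. g n x) \<longlonglongrightarrow> f x" if "x \<in> {0..1}" for x
  proof -
    have "(\<lambda>n. g n x - f x) \<longlonglongrightarrow> 0"
      by (rule Lim_null_comparison[OF _ LIMSEQ_inverse_real_of_nat])
         (use gf[OF that] in \<open>simp add: abs_minus_commute inverse_eq_divide less_imp_le del: of_nat_Suc\<close>)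
    then show ?thesis by (simp add: LIM_zero_iff)
  qed
  have g_bound: "\<bar>g n x\<bar> \<le> B + 1" if "x \<in> {0..1}" for n x
  proof -
    have "1 / real (Suc n) \<le> 1" by simp
    moreover have "\<bar>f x\<bar> \<le> B" using B that by blast
    ultimately show ?thesis using gf[OF that, of n] by linarith
  qed
  have lim: "(\<lambda>n. \<integral>x. g n (exp (- x)) \<partial>L) \<longlonglongrightarrow> (\<integral>x. f (exp (- x)) \<partial>L)"
    if L: "finite_measure L" "sets L = sets borel" "AE x in L. 0 \<le> x" for L :: "real measure"
  proof (rule integral_dominated_convergence[where w="\<lambda>_. B + 1"])
    interpret L: finite_measure L by fact
    have [measurable_cong]: "sets L = sets borel" by fact
    show "integrable L (\<lambda>_. B + 1)" by simp
    have [measurable]: "f \<in> borel_measurable borel" using f by (rule borel_measurable_continuous_onI)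
    have "g n \<in> borel_measurable borel" for n
      by (intro borel_measurable_continuous_onI continuous_on_polymonial_function)
        (simp add: g real_polynomial_function_eq[symmetric])
    note [measurable] = this
    show "(\<lambda>x. f (exp (- x))) \<in> borel_measurable L" by measurable
    show "(\<lambda>x. g n (exp (- x))) \<in> borel_measurable L" for n by measurable
    show "AE x in L. (\<lambda>n. g n (exp (- x))) \<longlonglongrightarrow> f (exp (- x))"
      using L(3) by eventually_elim (auto intro!: g_lim)
    show "AE x in L. norm (g n (exp (- x))) \<le> B + 1" for n
      using L(3) by eventually_elim (auto intro!: g_bound)
  qed
  have "(\<integral>x. g n (exp (- x)) \<partial>M) = (\<integral>x. g n (exp (- x)) \<partial>N)" for n
  proof -
    obtain a d where gn: "g n = (\<lambda>x. \<Sum>i\<le>d. a i * x ^ i)"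
      using g[of n] by (auto simp: real_polynomial_function_iff_sum)
    have int: "(\<integral>x. g n (exp (- x)) \<partial>L) = (\<Sum>i\<le>d. a i * (\<integral>x. exp (- real i * x) \<partial>L))"
      if L: "finite_measure L" "sets L = sets borel" "AE x in L. 0 \<le> x" for L :: "real measure"
    proof -
      interpret L: finite_measure L by fact
      have [measurable_cong]: "sets L = sets borel" by fact
      have "integrable L (\<lambda>x. exp (- real i * x))" for i
        by (rule L.integrable_const_bound[where B=1]) (use L(3) in auto)
      moreover have "exp (- x) ^ i = exp (- real i * x)" for x :: real and i
        using exp_of_nat_mult[of i "- x"] by simp
      ultimately show ?thesis by (simp add: gn)
    qed
    show ?thesis by (simp only: int[OF M] int[OF N] eq)
  qed
  with lim[OF M] lim[OF N] show ?thesis by (simp add: LIMSEQ_unique)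
qed

lemma laplace_unique_finite:
  fixes M N :: "real measure"
  assumes M: "finite_measure M" "sets M = sets borel" "AE x in M. 0 \<le> x"
    and N: "finite_measure N" "sets N = sets borel" "AE x in N. 0 \<le> x"
    and eq: "\<And>k::nat. (\<integral>x. exp (- real k * x) \<partial>M) = (\<integral>x. exp (- real k * x) \<partial>N)"
  shows "M = N"
proof (rule measure_eqI_lessThan)
  show "sets M = sets borel" "sets N = sets borel" by fact+
  interpret M: finite_measure M by fact
  interpret N: finite_measure N by fact
  show "emeasure M {a<..} < \<infinity>" for a by (simp add: M.emeasure_finite less_top[symmetric])
  \<comment> \<open>Continuous ramps in \<open>z = exp (- x)\<close> that increase to the indicator of \<open>a < x\<close>.\<close>
  fix a :: real
  define f where "f n z = min 1 (max 0 (real n * (exp (- a) - z)))" for n z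
  have lim: "(\<lambda>n. \<integral>x. f n (exp (- x)) \<partial>L) \<longlonglongrightarrow> measure L {a<..}"
    if L: "finite_measure L" "sets L = sets borel" for L :: "real measure"
  proof -
    interpret L: finite_measure L by fact
    have [measurable_cong]: "sets L = sets borel" by fact
    have "(\<lambda>n. \<integral>x. f n (exp (- x)) \<partial>L) \<longlonglongrightarrow> (\<integral>x. indicator {a<..} x \<partial>L)"
    proof (rule integral_dominated_convergence[where w="\<lambda>_. 1"])
      show "AE x in L. (\<lambda>n. f n (exp (- x))) \<longlonglongrightarrow> indicator {a<..} x"
      proof (rule AE_I2)
        fix x
        show "(\<lambda>n. f n (exp (- x))) \<longlonglongrightarrow> indicator {a<..} x"
        proof (cases "a < x")
          case True
          then have "0 < exp (- a) - exp (- x)" by simp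
          then obtain m where m: "1 < real m * (exp (- a) - exp (- x))"
            using ex_less_of_nat_mult by blast
          have "f n (exp (- x)) = 1" if "m \<le> n" for n
          proof -
            have "real m * (exp (- a) - exp (- x)) \<le> real n * (exp (- a) - exp (- x))"
              using that \<open>0 < exp (- a) - exp (- x)\<close> by (intro mult_right_mono) auto
            then show ?thesis using m by (simp add: f_def)
          qed
          then have "eventually (\<lambda>n. f n (exp (- x)) = 1) sequentially"
            by (auto simp: eventually_sequentially)
          then show ?thesis using True by (simp add: tendsto_eventually)
        next
          case False
          then have "f n (exp (- x)) = 0" for n by (simp add: f_def mult_nonneg_nonpos)
          then show ?thesis using False by simp
        qed
      qed
      show "(\<lambda>x. f n (exp (- x))) \<in> borel_measurable L" for n unfolding f_def by measurable
      show "AE x in L. norm (f n (exp (- x))) \<le> 1" for n by (simp add: f_def)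
    qed simp_all
    then show ?thesis using L sets_eq_imp_space_eq[OF L(2)] by simp
  qed
  have "(\<integral>x. f n (exp (- x)) \<partial>M) = (\<integral>x. f n (exp (- x)) \<partial>N)" for n
    by (rule integral_exp_minus_unique[OF M N eq, where f="f n"])
       (auto simp: f_def intro!: continuous_intros)
  with lim[OF M(1,2)] lim[OF N(1,2)] have "measure M {a<..} = measure N {a<..}"
    by (simp add: LIMSEQ_unique)
  then show "emeasure M {a<..} = emeasure N {a<..}"
    by (simp add: M.emeasure_eq_measure N.emeasure_eq_measure)
qed



text \<open>The measures may be infinite near \<open>0\<close>; tilting them by \<open>exp (- x)\<close> makes them finite and
  shifts the argument of the transform by \<open>1\<close>.\<close>

lemma laplace_unique:
  fixes M N :: "real measure"
  assumes M: "sets M = sets borel" "AE x in M. 0 \<le> x"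
    and N: "sets N = sets borel" "AE x in N. 0 \<le> x"
    and fin: "\<And>q. 0 < q \<Longrightarrow> (\<integral>\<^sup>+x. ennreal (exp (- q * x)) \<partial>M) < \<infinity>"
    and eq: "\<And>q. 0 < q \<Longrightarrow>
      (\<integral>\<^sup>+x. ennreal (exp (- q * x)) \<partial>M) = (\<integral>\<^sup>+x. ennreal (exp (- q * x)) \<partial>N)"
  shows "M = N"
proof -
  define tilt where "tilt L = density L (\<lambda>x. ennreal (exp (- x)))" for L :: "real measure"
  have tilt: "finite_measure (tilt L)" "sets (tilt L) = sets borel" "AE x in tilt L. 0 \<le> x"
    "\<And>k::nat. (\<integral>x. exp (- real k * x) \<partial>tilt L) = enn2real (\<integral>\<^sup>+x. ennreal (exp (- (real k + 1) * x)) \<partial>L)"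
    "density (tilt L) (\<lambda>x. ennreal (exp x)) = L"
    if L: "sets L = sets borel" "AE x in L. 0 \<le> x"
      "\<And>q. 0 < q \<Longrightarrow> (\<integral>\<^sup>+x. ennreal (exp (- q * x)) \<partial>L) < \<infinity>" for L
  proof -
    have [measurable_cong]: "sets L = sets borel" by fact
    show "finite_measure (tilt L)"
      using L(3)[of 1] unfolding tilt_def
      by (intro finite_measureI) (simp add: emeasure_density less_top)
    show "sets (tilt L) = sets borel" by (simp add: tilt_def L)
    show "AE x in tilt L. 0 \<le> x" unfolding tilt_def using L(2) by (subst AE_density) auto
    show "(\<integral>x. exp (- real k * x) \<partial>tilt L) = enn2real (\<integral>\<^sup>+x. ennreal (exp (- (real k + 1) * x)) \<partial>L)" for k
    proof -
      have "(\<integral>x. exp (- real k * x) \<partial>tilt L) = enn2real (\<integral>\<^sup>+x. ennreal (exp (- real k * x)) \<partial>tilt L)"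
        by (intro integral_eq_nn_integral) (auto simp: tilt_def)
      also have "(\<integral>\<^sup>+x. ennreal (exp (- real k * x)) \<partial>tilt L) =
          (\<integral>\<^sup>+x. ennreal (exp (- x)) * ennreal (exp (- real k * x)) \<partial>L)"
        unfolding tilt_def by (intro nn_integral_density) auto
      also have "\<dots> = (\<integral>\<^sup>+x. ennreal (exp (- (real k + 1) * x)) \<partial>L)"
        by (intro nn_integral_cong) (simp add: ennreal_mult[symmetric] exp_add[symmetric] left_diff_distrib)
      finally show ?thesis .
    qed
    have "density (tilt L) (\<lambda>x. ennreal (exp x)) = density L (\<lambda>x. ennreal (exp (- x)) * ennreal (exp x))"
      unfolding tilt_def by (intro density_density_eq) auto
    also have "\<dots> = density L (\<lambda>_. 1)"
      by (intro density_cong) (auto simp: ennreal_mult[symmetric] exp_minus)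
    finally show "density (tilt L) (\<lambda>x. ennreal (exp x)) = L" by (simp add: density_1)
  qed
  have finN: "(\<integral>\<^sup>+x. ennreal (exp (- q * x)) \<partial>N) < \<infinity>" if "0 < q" for q
    using fin[OF that] eq[OF that] by metis
  have "tilt M = tilt N"
  proof (rule laplace_unique_finite[OF tilt(1-3)[OF M fin] tilt(1-3)[OF N finN]])
    show "(\<integral>x. exp (- real k * x) \<partial>tilt M) = (\<integral>x. exp (- real k * x) \<partial>tilt N)" for k
    proof -
      have "(\<integral>x. exp (- real k * x) \<partial>tilt M) = enn2real (\<integral>\<^sup>+x. ennreal (exp (- (real k + 1) * x)) \<partial>M)"
        by (rule tilt(4)[OF M fin])
      also have "\<dots> = enn2real (\<integral>\<^sup>+x. ennreal (exp (- (real k + 1) * x)) \<partial>N)"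
        by (subst eq) auto
      also have "\<dots> = (\<integral>x. exp (- real k * x) \<partial>tilt N)"
        by (rule tilt(4)[OF N finN, symmetric])
      finally show ?thesis .
    qed
  qed
  then show ?thesis using tilt(5)[OF M fin] tilt(5)[OF N finN] by metis
qed

section \<open>Scaling of the branching mechanism\<close>

definition levy_kernel :: "real \<Rightarrow> real" where
  "levy_kernel r = exp (- r) - 1 + r"

lemma levy_kernel_DERIV: "((\<lambda>r. levy_kernel (c * r)) has_real_derivative c * (1 - exp (- (c * r)))) (at r)"
  unfolding levy_kernel_def by (auto intro!: derivative_eq_intros simp: algebra_simps)

lemma levy_kernel_nonneg: "0 \<le> levy_kernel r"
  using exp_ge_add_one_self[of "- r"] by (simp add: levy_kernel_def)

lemma levy_kernel_measurable [measurable]: "levy_kernel \<in> borel_measurable borel"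
  unfolding levy_kernel_def by measurable

text \<open>This inequality and the next one express that \<open>levy_kernel r / r\<close> increases and
  \<open>levy_kernel r / r\<^sup>2\<close> decreases.\<close>

lemma levy_kernel_scale_lower:
  assumes c: "1 \<le> c" and r: "0 \<le> r"
  shows "c * levy_kernel r \<le> levy_kernel (c * r)"
proof -
  have "levy_kernel (c * 0) - c * levy_kernel (1 * 0) \<le> levy_kernel (c * r) - c * levy_kernel (1 * r)"
  proof (rule DERIV_nonneg_imp_nondecreasing[OF r])
    fix x :: real assume "0 \<le> x"
    have "((\<lambda>r. levy_kernel (c * r) - c * levy_kernel (1 * r)) has_real_derivative
        c * (1 - exp (- (c * x))) - c * (1 * (1 - exp (- (1 * x))))) (at x)"
      by (intro DERIV_diff DERIV_cmult levy_kernel_DERIV)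
    moreover have "exp (- (c * x)) \<le> exp (- x)"
      using mult_right_mono[OF c \<open>0 \<le> x\<close>] by simp
    then have "0 \<le> c * (1 - exp (- (c * x))) - c * (1 * (1 - exp (- (1 * x))))"
      using c by (simp add: right_diff_distrib[symmetric])
    ultimately show "\<exists>y. ((\<lambda>r. levy_kernel (c * r) - c * levy_kernel (1 * r)) has_real_derivative y) (at x) \<and> 0 \<le> y"
      by blast
  qed
  then show ?thesis by (simp add: levy_kernel_def)
qed

lemma levy_kernel_scale_upper:
  assumes c: "1 \<le> c" and r: "0 \<le> r"
  shows "levy_kernel (c * r) \<le> c\<^sup>2 * levy_kernel r"
proof -
  have *: "1 - exp (- (c * x)) \<le> c * (1 - exp (- x))" if "0 \<le> x" for x
  proof -
    have "c * (1 - exp (- 0)) - (1 - exp (- (c * 0))) \<le> c * (1 - exp (- x)) - (1 - exp (- (c * x)))"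
    proof (rule DERIV_nonneg_imp_nondecreasing[OF that])
      fix y :: real assume "0 \<le> y"
      have "((\<lambda>x. c * (1 - exp (- x)) - (1 - exp (- (c * x)))) has_real_derivative
          c * (exp (- y) - exp (- (c * y)))) (at y)"
        by (auto intro!: derivative_eq_intros simp: algebra_simps)
      moreover have "0 \<le> c * (exp (- y) - exp (- (c * y)))"
        using c mult_right_mono[OF c \<open>0 \<le> y\<close>] by simp
      ultimately show "\<exists>D. ((\<lambda>x. c * (1 - exp (- x)) - (1 - exp (- (c * x)))) has_real_derivative D) (at y) \<and> 0 \<le> D"
        by blast
    qed
    then show ?thesis by simp
  qed
  have "c\<^sup>2 * levy_kernel (1 * 0) - levy_kernel (c * 0) \<le> c\<^sup>2 * levy_kernel (1 * r) - levy_kernel (c * r)"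
  proof (rule DERIV_nonneg_imp_nondecreasing[OF r])
    fix x :: real assume x: "0 \<le> x"
    have "((\<lambda>r. c\<^sup>2 * levy_kernel (1 * r) - levy_kernel (c * r)) has_real_derivative
        c\<^sup>2 * (1 * (1 - exp (- (1 * x)))) - c * (1 - exp (- (c * x)))) (at x)"
      by (intro DERIV_diff DERIV_cmult levy_kernel_DERIV)
    moreover have "c * (1 - exp (- (c * x))) \<le> c * (c * (1 - exp (- x)))"
      using c *[OF x] by (intro mult_left_mono) auto
    then have "0 \<le> c\<^sup>2 * (1 * (1 - exp (- (1 * x)))) - c * (1 - exp (- (c * x)))"
      by (simp add: power2_eq_square mult.assoc)
    ultimately show "\<exists>y. ((\<lambda>r. c\<^sup>2 * levy_kernel (1 * r) - levy_kernel (c * r)) has_real_derivative y) (at x) \<and> 0 \<le> y"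
      by blast
  qed
  then show ?thesis by (simp add: levy_kernel_def)
qed

lemma levy_kernel_le:
  assumes "0 \<le> r"
  shows "levy_kernel r \<le> r" "levy_kernel r \<le> r\<^sup>2"
proof -
  show "levy_kernel r \<le> r" using assms by (simp add: levy_kernel_def)
  have "(1 * r)\<^sup>2 - levy_kernel (1 * r) \<ge> (1 * 0)\<^sup>2 - levy_kernel (1 * 0)"
  proof (rule DERIV_nonneg_imp_nondecreasing[OF assms])
    fix x :: real assume "0 \<le> x"
    have "((\<lambda>r. (1 * r)\<^sup>2 - levy_kernel (1 * r)) has_real_derivative
        2 * x - 1 * (1 - exp (- (1 * x)))) (at x)"
      by (intro DERIV_diff levy_kernel_DERIV) (auto intro!: derivative_eq_intros)
    moreover have "0 \<le> 2 * x - 1 * (1 - exp (- (1 * x)))"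
      using exp_ge_add_one_self[of "- x"] \<open>0 \<le> x\<close> by simp
    ultimately show "\<exists>y. ((\<lambda>r. (1 * r)\<^sup>2 - levy_kernel (1 * r)) has_real_derivative y) (at x) \<and> 0 \<le> y"
      by blast
  qed
  then show "levy_kernel r \<le> r\<^sup>2" by (simp add: levy_kernel_def)
qed

context branching_mechanism
begin

abbreviation mech :: "real \<Rightarrow> real" where
  "mech \<equiv> branching_mech \<alpha> \<sigma> \<pi>"

lemma space_pi: "space \<pi> = {0<..}"
  using sets_eq_imp_space_eq[OF sets_pi] by (simp add: space_restrict_space)

lemma measurable_pi: "f \<in> borel_measurable borel \<Longrightarrow> f \<in> borel_measurable \<pi>"
  by (simp add: measurable_cong_sets[OF sets_pi refl] measurable_restrict_space1)

lemma integrable_min_pi: "integrable \<pi> (\<lambda>r. min r (r\<^sup>2))"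
  using moment_pi
  by (intro integrableI_nonneg measurable_pi) (auto intro!: AE_I2 simp: space_pi)

lemma levy_kernel_le_min:
  assumes "0 < q" "0 < r"
  shows "levy_kernel (q * r) \<le> (q + q\<^sup>2) * min r (r\<^sup>2)"
proof (cases "r \<le> r\<^sup>2")
  case True
  with levy_kernel_le(1)[of "q * r"] assms show ?thesis
    by (simp add: distrib_right min_def) (smt (verit) mult_nonneg_nonneg zero_le_power2)
next
  case False
  with levy_kernel_le(2)[of "q * r"] assms show ?thesis
    by (simp add: distrib_right min_def power_mult_distrib) (smt (verit) mult_nonneg_nonneg zero_le_power2)
qed

lemma integrable_levy_kernel:
  assumes "0 < q"
  shows "integrable \<pi> (\<lambda>r. levy_kernel (q * r))"
proof (rule Bochner_Integration.integrable_bound[OF integrable_mult_right[OF integrable_min_pi]])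
  show "AE r in \<pi>. norm (levy_kernel (q * r)) \<le> norm ((q + q\<^sup>2) * min r (r\<^sup>2))"
    using levy_kernel_le_min[OF assms] assms
    by (intro AE_I2) (auto simp: space_pi levy_kernel_nonneg abs_mult)
qed (intro measurable_pi, measurable)

lemma mech_eq:
  "mech q = \<alpha> * q + \<sigma>\<^sup>2 * q\<^sup>2 / 2 + (\<integral>r. levy_kernel (q * r) \<partial>\<pi>)"
  by (simp add: branching_mech_def levy_kernel_def)

lemma mech_ge_linear: "0 < q \<Longrightarrow> \<alpha> * q \<le> mech q"
  by (simp add: mech_eq levy_kernel_nonneg)

lemma mech_nonneg: "0 < q \<Longrightarrow> 0 \<le> mech q"
  using mech_ge_linear[of q] alpha_nonneg by (smt (verit) mult_nonneg_nonneg)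

text \<open>Positivity, monotonicity and continuity of the mechanism, and the comparisons of \<open>phi\<close> with
  elementary functions, all follow from the two-sided scaling bound: \<open>mech q / q\<close> increases and
  \<open>mech q / q\<^sup>2\<close> decreases, because this holds for each of the three terms.\<close>

lemma mech_scale_lower:
  assumes "1 \<le> c" "0 < q"
  shows "c * mech q \<le> mech (c * q)"
proof -
  have "c * (\<integral>r. levy_kernel (q * r) \<partial>\<pi>) = (\<integral>r. c * levy_kernel (q * r) \<partial>\<pi>)" by simp
  also have "\<dots> \<le> (\<integral>r. levy_kernel (c * q * r) \<partial>\<pi>)"
    using assms levy_kernel_scale_lower[of c "q * r" for r]
    by (intro integral_mono integrable_mult_right integrable_levy_kernel) (auto simp: space_pi mult.assoc)
  finally have 1: "c * (\<integral>r. levy_kernel (q * r) \<partial>\<pi>) \<le> (\<integral>r. levy_kernel (c * q * r) \<partial>\<pi>)" .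
  have "c * (\<sigma>\<^sup>2 * q\<^sup>2 / 2) \<le> c\<^sup>2 * (\<sigma>\<^sup>2 * q\<^sup>2 / 2)"
    using assms by (intro mult_right_mono) (auto simp: power2_eq_square)
  with 1 show ?thesis by (simp add: mech_eq algebra_simps power_mult_distrib)
qed

lemma mech_scale_upper:
  assumes "1 \<le> c" "0 < q"
  shows "mech (c * q) \<le> c\<^sup>2 * mech q"
proof -
  have "(\<integral>r. levy_kernel (c * q * r) \<partial>\<pi>) \<le> (\<integral>r. c\<^sup>2 * levy_kernel (q * r) \<partial>\<pi>)"
    using assms levy_kernel_scale_upper[of c "q * r" for r]
    by (intro integral_mono integrable_mult_right integrable_levy_kernel) (auto simp: space_pi mult.assoc)
  then have 1: "(\<integral>r. levy_kernel (c * q * r) \<partial>\<pi>) \<le> c\<^sup>2 * (\<integral>r. levy_kernel (q * r) \<partial>\<pi>)" by simp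
  have "c * (\<alpha> * q) \<le> c\<^sup>2 * (\<alpha> * q)"
    using assms alpha_nonneg by (intro mult_right_mono) (auto simp: power2_eq_square)
  with 1 show ?thesis by (simp add: mech_eq algebra_simps power_mult_distrib)
qed

text \<open>A zero of the mechanism would propagate to all larger arguments by the quadratic upper bound.\<close>

lemma mech_pos:
  assumes q: "0 < q"
  shows "0 < mech q"
proof (rule ccontr)
  assume "\<not> 0 < mech q"
  with mech_nonneg[OF q] have "mech q = 0" by simp
  have "eventually (\<lambda>x. 1 \<le> mech x) at_top"
    using mech_at_top by (simp add: filterlim_at_top)
  then obtain p where p: "\<And>x. p \<le> x \<Longrightarrow> 1 \<le> mech x" by (auto simp: eventually_at_top_linorder)
  define c where "c = max 1 (p / q)"
  have "p \<le> c * q" using q by (simp add: c_def max_def field_simps)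
  with p have "1 \<le> mech (c * q)" by blast
  also have "\<dots> \<le> c\<^sup>2 * mech q" using q by (intro mech_scale_upper) (auto simp: c_def)
  finally show False using \<open>mech q = 0\<close> by simp
qed

lemma mech_le_linear: "0 < p \<Longrightarrow> p \<le> q \<Longrightarrow> mech p \<le> mech q / q * p"
  using mech_scale_lower[of "q / p" p] by (simp add: field_simps)

lemma mech_ge_quadratic: "0 < p \<Longrightarrow> p \<le> q \<Longrightarrow> mech q / q\<^sup>2 * p\<^sup>2 \<le> mech p"
  using mech_scale_upper[of "q / p" p] by (simp add: field_simps power_divide)

lemma mech_mono:
  assumes "0 < p" "p \<le> q"
  shows "mech p \<le> mech q"
proof -
  have "mech p * 1 \<le> mech p * (q / p)"
    using assms mech_nonneg[of p] by (intro mult_left_mono) auto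
  also have "\<dots> \<le> mech (q / p * p)"
    using mech_scale_lower[of "q / p" p] assms by (simp add: mult.commute)
  finally show ?thesis using assms by simp
qed

text \<open>Near \<open>q\<close> the mechanism lies between the smaller and the larger of \<open>(p / q) * mech q\<close> and
  \<open>(p / q)\<^sup>2 * mech q\<close>.\<close>

lemma mech_isCont:
  assumes q: "0 < q"
  shows "isCont mech q"
proof -
  define b where "b p = max ((p / q)\<^sup>2) (p / q) * mech q" for p
  define a where "a p = min ((p / q)\<^sup>2) (p / q) * mech q" for p
  have ab: "a p \<le> mech p \<and> mech p \<le> b p" if "0 < p" for p
  proof (cases "q \<le> p")
    case True
    then have "p / q \<le> (p / q)\<^sup>2" using q by (simp add: power2_eq_square field_simps)
    then show ?thesis using mech_scale_lower[of "p / q" q] mech_scale_upper[of "p / q" q] q True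
      by (simp add: a_def b_def min_def max_def)
  next
    case False
    then have "(p / q)\<^sup>2 \<le> p / q" using q that by (simp add: power2_eq_square field_simps)
    then show ?thesis using mech_le_linear[of p q] mech_ge_quadratic[of p q] q False that
      by (simp add: a_def b_def min_def max_def power_divide mult.commute)
  qed
  have ev: "eventually (\<lambda>p. 0 < p) (at q)"
    using q by (intro order_tendstoD(1)[OF tendsto_ident_at])
  have "(b \<longlongrightarrow> b q) (at q)" "(a \<longlongrightarrow> a q) (at q)"
    unfolding a_def b_def using q
    by (intro tendsto_mult tendsto_max tendsto_min tendsto_power tendsto_divide tendsto_const
        tendsto_ident_at; simp)+
  moreover have "a q = mech q" "b q = mech q" using q by (auto simp: a_def b_def)
  ultimately have "(mech \<longlongrightarrow> mech q) (at q)"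
    using ev ab by (intro tendsto_sandwich[of a mech "at q" b]) (auto elim: eventually_mono)
  then show ?thesis by (simp add: isCont_def)
qed

text \<open>Dominated convergence, after the substitution \<open>q = 1 / t\<close>.\<close>

lemma mech_slope_at_0: "((\<lambda>q. mech q / q) \<longlongrightarrow> \<alpha>) (at_right 0)"
  unfolding filterlim_at_right_to_top
proof -
  have "((\<lambda>t. \<integral>r. t * levy_kernel (inverse t * r) \<partial>\<pi>) \<longlongrightarrow> (\<integral>r. 0 \<partial>\<pi>)) at_top"
  proof (rule integral_dominated_convergence_at_top[where w="\<lambda>r. 2 * min r (r\<^sup>2)"])
    show "integrable \<pi> (\<lambda>r. 2 * min r (r\<^sup>2))"
      by (intro integrable_mult_right integrable_min_pi)
    show "AE r in \<pi>. ((\<lambda>t. t * levy_kernel (inverse t * r)) \<longlongrightarrow> 0) at_top"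
    proof (rule AE_I2)
      fix r assume "r \<in> space \<pi>"
      then have r: "0 < r" by (simp add: space_pi)
      have "((\<lambda>t. r\<^sup>2 * inverse t) \<longlongrightarrow> 0) at_top"
        by (intro tendsto_mult_right_zero tendsto_inverse_0_at_top filterlim_ident)
      then show "((\<lambda>t. t * levy_kernel (inverse t * r)) \<longlongrightarrow> 0) at_top"
      proof (rule Lim_null_comparison[rotated])
        show "\<forall>\<^sub>F t in at_top. norm (t * levy_kernel (inverse t * r)) \<le> r\<^sup>2 * inverse t"
          using eventually_gt_at_top[of 0]
        proof eventually_elim
          case (elim t)
          then have "t * levy_kernel (inverse t * r) \<le> t * (inverse t * r)\<^sup>2"
            using r by (intro mult_left_mono levy_kernel_le) auto
          then show ?case using elim
            by (simp add: abs_mult levy_kernel_nonneg power2_eq_square field_simps)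
        qed
      qed
    qed
    show "\<forall>\<^sub>F t in at_top. AE r in \<pi>. norm (t * levy_kernel (inverse t * r)) \<le> 2 * min r (r\<^sup>2)"
      using eventually_ge_at_top[of 1]
    proof eventually_elim
      case (elim t)
      show ?case
      proof (rule AE_I2)
        fix r assume "r \<in> space \<pi>"
        then have r: "0 < r" by (simp add: space_pi)
        have "t * levy_kernel (inverse t * r) \<le> t * ((inverse t + (inverse t)\<^sup>2) * min r (r\<^sup>2))"
          using elim r by (intro mult_left_mono levy_kernel_le_min) auto
        also have "\<dots> = (1 + inverse t) * min r (r\<^sup>2)"
          using elim by (simp add: field_simps power2_eq_square)
        also have "\<dots> \<le> 2 * min r (r\<^sup>2)"
          using elim r by (intro mult_right_mono) (auto simp: inverse_le_1_iff)
        finally show "norm (t * levy_kernel (inverse t * r)) \<le> 2 * min r (r\<^sup>2)"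
          using elim by (simp add: abs_mult levy_kernel_nonneg)
      qed
    qed
    show "(\<lambda>r. t * levy_kernel (inverse t * r)) \<in> borel_measurable \<pi>" for t
      by (intro measurable_pi) measurable
  qed simp
  moreover have "((\<lambda>t. \<alpha> + \<sigma>\<^sup>2 / 2 * inverse t) \<longlongrightarrow> \<alpha> + \<sigma>\<^sup>2 / 2 * 0) at_top"
    by (intro tendsto_intros tendsto_inverse_0_at_top filterlim_ident)
  ultimately have "((\<lambda>t. (\<alpha> + \<sigma>\<^sup>2 / 2 * inverse t) + (\<integral>r. t * levy_kernel (inverse t * r) \<partial>\<pi>))
      \<longlongrightarrow> (\<alpha> + \<sigma>\<^sup>2 / 2 * 0) + (\<integral>r. 0 \<partial>\<pi>)) at_top"
    by (rule tendsto_add[rotated])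
  then have lim: "((\<lambda>t. \<alpha> + \<sigma>\<^sup>2 / 2 * inverse t + (\<integral>r. t * levy_kernel (inverse t * r) \<partial>\<pi>))
      \<longlongrightarrow> \<alpha>) at_top" by simp
  have "\<forall>\<^sub>F t in at_top. \<alpha> + \<sigma>\<^sup>2 / 2 * inverse t + (\<integral>r. t * levy_kernel (inverse t * r) \<partial>\<pi>) =
      mech (inverse t) / inverse t"
    using eventually_gt_at_top[of 0]
    by eventually_elim (simp add: mech_eq field_simps power2_eq_square)
  with lim show "((\<lambda>t. mech (inverse t) / inverse t) \<longlongrightarrow> \<alpha>) at_top"
    by (rule Lim_transform_eventually)
qed

end

section \<open>The extinction-time function and its inverse\<close>

context branching_mechanism
begin

abbreviation phi :: "real \<Rightarrow> real" where
  "phi \<equiv> ext_time mech"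

abbreviation phi_inv :: "real \<Rightarrow> real" where
  "phi_inv \<equiv> ext_time_inv mech"

lemma continuous_on_inverse_mech: "S \<subseteq> {0<..} \<Longrightarrow> continuous_on S (\<lambda>v. 1 / mech v)"
  using mech_isCont mech_pos
  by (intro continuous_at_imp_continuous_on ballI continuous_divide continuous_const)
     (auto simp: subset_eq less_imp_neq[symmetric])

lemma set_integrable_inverse_mech:
  assumes q: "0 < q"
  shows "set_integrable lborel {q..} (\<lambda>v. 1 / mech v)"
proof -
  obtain c where c: "0 < c" "set_integrable lborel {c..} (\<lambda>v. 1 / mech v)"
    using mech_integrable_at_top by auto
  have "set_integrable lborel {q..max q c} (\<lambda>v. 1 / mech v)"
    unfolding set_integrable_def
    by (rule borel_integrable_compact) (use q in \<open>auto intro: continuous_on_inverse_mech\<close>)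
  then have "set_integrable lborel ({q..max q c} \<union> {c..}) (\<lambda>v. 1 / mech v)"
    using c by (intro set_integrable_Un) auto
  then show ?thesis by (rule set_integrable_subset) auto
qed

lemma phi_diff:
  assumes "0 < p" "p \<le> q"
  shows "phi p - phi q = (LBINT v:{p..q}. 1 / mech v)"
proof -
  have I: "set_integrable lborel A (\<lambda>v. 1 / mech v)" if "A \<subseteq> {p..}" "A \<in> sets lborel" for A
    using set_integrable_inverse_mech[OF assms(1)] that by (rule_tac set_integrable_subset)
  have "phi p = (LBINT v:{p<..q} \<union> {q<..}. 1 / mech v)"
    using assms by (simp add: ext_time_def ivl_disj_un)
  also have "\<dots> = (LBINT v:{p<..q}. 1 / mech v) + phi q"
    unfolding ext_time_def using assms by (intro set_integral_Un I) auto
  also have "(LBINT v:{p<..q}. 1 / mech v) = (LBINT v:{p..q}. 1 / mech v)"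
    by (rule set_integral_discrete_difference[where X="{p}"]) (use assms in auto)
  finally show ?thesis by simp
qed

lemma phi_DERIV:
  assumes q: "0 < q"
  shows "(phi has_real_derivative - (1 / mech q)) (at q)"
proof -
  have cont: "continuous_on {q / 2..2 * q} (\<lambda>v. 1 / mech v)"
    using q by (intro continuous_on_inverse_mech) auto
  have "((\<lambda>x. phi (q / 2) - integral {q / 2..x} (\<lambda>v. 1 / mech v)) has_real_derivative 0 - 1 / mech q)
      (at q within {q / 2..2 * q})"
    using q by (intro DERIV_diff DERIV_const integral_has_real_derivative[OF cont]) auto
  then have "((\<lambda>x. phi (q / 2) - integral {q / 2..x} (\<lambda>v. 1 / mech v)) has_real_derivative 0 - 1 / mech q)
      (at q)"
    using q by (subst (asm) at_within_Icc_at) auto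
  moreover have "eventually (\<lambda>x. phi (q / 2) - integral {q / 2..x} (\<lambda>v. 1 / mech v) = phi x) (nhds q)"
  proof -
    have "eventually (\<lambda>x. x \<in> {q / 2<..}) (nhds q)"
      using q by (intro eventually_nhds_in_open) auto
    then show ?thesis
    proof eventually_elim
      case (elim x)
      have "set_integrable lborel {q / 2..x} (\<lambda>v. 1 / mech v)"
        using q by (rule_tac set_integrable_subset[OF set_integrable_inverse_mech[of "q / 2"]]) auto
      then show ?case
        using phi_diff[of "q / 2" x] q elim by (simp add: set_borel_integral_eq_integral(2))
    qed
  qed
  ultimately show ?thesis by (subst (asm) DERIV_cong_ev) (auto)
qed

text \<open>Bounds on the derivative of \<open>phi\<close> integrate to bounds on its increments; the mechanism is compared
  with a constant, a linear and a quadratic function.\<close>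

lemma phi_diff_le:
  assumes "0 < p" "p \<le> q"
    and G: "\<And>x. p \<le> x \<Longrightarrow> x \<le> q \<Longrightarrow> (G has_real_derivative g x) (at x)"
    and g: "\<And>x. p \<le> x \<Longrightarrow> x \<le> q \<Longrightarrow> 1 / mech x \<le> g x"
  shows "phi p - phi q \<le> G q - G p"
proof -
  have "G p + phi p \<le> G q + phi q"
  proof (rule DERIV_nonneg_imp_nondecreasing[OF \<open>p \<le> q\<close>])
    fix x assume x: "p \<le> x" "x \<le> q"
    show "\<exists>y. ((\<lambda>x. G x + phi x) has_real_derivative y) (at x) \<and> 0 \<le> y"
      using DERIV_add[OF G[OF x] phi_DERIV] g[OF x] assms(1) x by force
  qed
  then show ?thesis by simp
qed

lemma phi_diff_ge:
  assumes "0 < p" "p \<le> q"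
    and G: "\<And>x. p \<le> x \<Longrightarrow> x \<le> q \<Longrightarrow> (G has_real_derivative g x) (at x)"
    and g: "\<And>x. p \<le> x \<Longrightarrow> x \<le> q \<Longrightarrow> g x \<le> 1 / mech x"
  shows "G q - G p \<le> phi p - phi q"
proof -
  have "G q + phi q \<le> G p + phi p"
  proof (rule DERIV_nonpos_imp_nonincreasing[OF \<open>p \<le> q\<close>])
    fix x assume x: "p \<le> x" "x \<le> q"
    show "\<exists>y. ((\<lambda>x. G x + phi x) has_real_derivative y) (at x) \<and> y \<le> 0"
      using DERIV_add[OF G[OF x] phi_DERIV] g[OF x] assms(1) x by force
  qed
  then show ?thesis by simp
qed

lemma phi_diff_le_linear:
  assumes "0 < p" "p \<le> q"
  shows "phi p - phi q \<le> (q - p) / mech p"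
proof -
  have "phi p - phi q \<le> q / mech p - p / mech p"
    by (rule phi_diff_le[OF assms, where g="\<lambda>_. 1 / mech p"])
       (use assms mech_pos[of p] mech_mono[of p] in \<open>auto intro!: derivative_eq_intros frac_le\<close>)
  then show ?thesis by (simp add: diff_divide_distrib)
qed

lemma phi_diff_ge_ln:
  assumes "0 < p" "p \<le> q"
  shows "q / mech q * ln (q / p) \<le> phi p - phi q"
proof -
  have "q / mech q * ln q - q / mech q * ln p \<le> phi p - phi q"
  proof (rule phi_diff_ge[OF assms, where g="\<lambda>x. q / mech q * (1 / x)"])
    fix x assume x: "p \<le> x" "x \<le> q"
    with assms have "0 < x" "0 < q" by auto
    show "((\<lambda>x. q / mech q * ln x) has_real_derivative q / mech q * (1 / x)) (at x)"
      using \<open>0 < x\<close> mech_pos[OF \<open>0 < q\<close>] by (auto intro!: derivative_eq_intros)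
    show "q / mech q * (1 / x) \<le> 1 / mech x"
      using mech_le_linear[of x q] mech_pos[of x] mech_pos[of q] \<open>0 < x\<close> \<open>0 < q\<close> x
      by (simp add: field_simps)
  qed
  then show ?thesis using assms by (simp add: ln_div right_diff_distrib)
qed

lemma phi_diff_le_quadratic:
  assumes "0 < p" "p \<le> q"
  shows "phi p - phi q \<le> q / p * ((q - p) / mech q)"
proof -
  have "phi p - phi q \<le> - (q\<^sup>2 / mech q * inverse q) - - (q\<^sup>2 / mech q * inverse p)"
  proof (rule phi_diff_le[OF assms, where g="\<lambda>x. q\<^sup>2 / mech q * inverse (x\<^sup>2)"])
    fix x assume x: "p \<le> x" "x \<le> q"
    with assms have "0 < x" "0 < q" by auto
    show "((\<lambda>x. - (q\<^sup>2 / mech q * inverse x)) has_real_derivative q\<^sup>2 / mech q * inverse (x\<^sup>2)) (at x)"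
      using \<open>0 < x\<close> mech_pos[OF \<open>0 < q\<close>] by (auto intro!: derivative_eq_intros simp: power2_eq_square)
    show "1 / mech x \<le> q\<^sup>2 / mech q * inverse (x\<^sup>2)"
      using mech_ge_quadratic[of x q] mech_pos[of x] mech_pos[of q] \<open>0 < x\<close> \<open>0 < q\<close> x
      by (simp add: field_simps)
  qed
  also have "\<dots> = q / p * ((q - p) / mech q)"
    using assms mech_pos[of q] by (simp add: field_simps power2_eq_square)
  finally show ?thesis .
qed

lemma phi_strict_antimono:
  assumes "0 < p" "p < q"
  shows "phi q < phi p"
proof -
  have "0 < q / mech q * ln (q / p)" using assms mech_pos[of q] by simp
  then show ?thesis using phi_diff_ge_ln[of p q] assms by simp
qed

lemma phi_less_iff: "0 < p \<Longrightarrow> 0 < q \<Longrightarrow> phi p < phi q \<longleftrightarrow> q < p"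
  using phi_strict_antimono[of p q] phi_strict_antimono[of q p] by (cases p q rule: linorder_cases) auto

lemma phi_pos: "0 < q \<Longrightarrow> 0 < phi q"
proof -
  assume q: "0 < q"
  have "0 \<le> phi (q + 1)"
    unfolding ext_time_def set_lebesgue_integral_def
    using q by (intro integral_nonneg_AE AE_I2) (auto simp: mech_nonneg split: split_indicator)
  then show ?thesis using phi_strict_antimono[of q "q + 1"] q by simp
qed

lemma phi_tendsto_0: "(phi \<longlongrightarrow> 0) at_top"
proof -
  have "((\<lambda>b. LBINT v:{1..b}. 1 / mech v) \<longlongrightarrow> (LBINT v:{1..}. 1 / mech v)) at_top"
    by (intro tendsto_set_lebesgue_integral_at_top set_integrable_inverse_mech) auto
  moreover have "(LBINT v:{1..}. 1 / mech v) = phi 1"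
    unfolding ext_time_def by (rule set_integral_discrete_difference[where X="{1}"]) auto
  ultimately have "((\<lambda>b. phi 1 - (LBINT v:{1..b}. 1 / mech v)) \<longlongrightarrow> phi 1 - phi 1) at_top"
    by (intro tendsto_diff tendsto_const) simp
  then have "((\<lambda>b. phi 1 - (LBINT v:{1..b}. 1 / mech v)) \<longlongrightarrow> 0) at_top" by simp
  moreover have "eventually (\<lambda>b. phi 1 - (LBINT v:{1..b}. 1 / mech v) = phi b) at_top"
    using eventually_ge_at_top[of 1] by eventually_elim (simp add: phi_diff[of 1, symmetric])
  ultimately show ?thesis by (rule Lim_transform_eventually)
qed

lemma phi_surj:
  assumes t: "0 < t"
  shows "\<exists>q>0. phi q = t"
proof -
  have "eventually (\<lambda>q. phi q < t \<and> 1 \<le> q) at_top"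
    using order_tendstoD(2)[OF phi_tendsto_0 t] eventually_ge_at_top by (rule eventually_conj)
  then obtain b where b: "phi b < t" "1 \<le> b"
    using eventually_happens'[OF trivial_limit_at_top_linorder] by blast
  \<comment> \<open>The point where the logarithmic lower bound for \<open>phi a - phi b\<close> equals \<open>t\<close>.\<close>
  define a where "a = b * exp (- t * mech b / b)"
  have "0 < t * mech b / b" using b mech_pos[of b] t by simp
  then have "0 < a" "a \<le> b" using b by (auto simp: a_def)
  have "ln (b / a) = t * mech b / b"
    using b by (simp add: a_def ln_div ln_mult)
  then have "t \<le> phi a - phi b"
    using phi_diff_ge_ln[OF \<open>0 < a\<close> \<open>a \<le> b\<close>] b mech_pos[of b] by simp
  then have "t \<le> phi a" using phi_pos[of b] b by simp
  moreover have "continuous_on {a..b} phi"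
    using \<open>0 < a\<close> by (intro DERIV_continuous_on[where D="\<lambda>q. - (1 / mech q)"])
      (auto intro!: has_field_derivative_at_within phi_DERIV)
  ultimately obtain q where "a \<le> q" "q \<le> b" "phi q = t"
    using IVT2'[of phi b t a] b \<open>a \<le> b\<close> by auto
  then show ?thesis using \<open>0 < a\<close> by (intro exI[of _ q]) auto
qed

lemma phi_inv_pos: "0 < t \<Longrightarrow> 0 < phi_inv t"
  and phi_phi_inv: "0 < t \<Longrightarrow> phi (phi_inv t) = t"
proof -
  assume "0 < t"
  then have t: "t \<in> phi ` {0<..}" using phi_surj[of t] by auto
  show "0 < phi_inv t" using inv_into_into[OF t] by (simp add: ext_time_inv_def)
  show "phi (phi_inv t) = t" using f_inv_into_f[OF t] by (simp add: ext_time_inv_def)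
qed

lemma phi_inv_eqI:
  assumes "0 < q" "phi q = t"
  shows "phi_inv t = q"
proof -
  have "0 < t" using phi_pos[OF assms(1)] assms(2) by simp
  with assms show ?thesis
    using phi_less_iff[of q "phi_inv t"] phi_less_iff[of "phi_inv t" q]
    by (simp add: phi_inv_pos phi_phi_inv)
qed

lemma phi_inv_less: "0 < s \<Longrightarrow> s < t \<Longrightarrow> phi_inv t < phi_inv s"
  using phi_less_iff[of "phi_inv s" "phi_inv t"] by (simp add: phi_inv_pos phi_phi_inv)

lemma phi_inv_at_right_0: "filterlim phi_inv (at_right 0) at_top"
proof (rule tendsto_imp_filterlim_at_right)
  show "eventually (\<lambda>t. phi_inv t > 0) at_top"
    using eventually_gt_at_top[of 0] by eventually_elim (rule phi_inv_pos)
  show "(phi_inv \<longlongrightarrow> 0) at_top"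
  proof (rule order_tendstoI)
    fix a :: real assume "0 < a"
    show "eventually (\<lambda>t. phi_inv t < a) at_top"
      using eventually_gt_at_top[of "phi a"]
    proof eventually_elim
      case (elim t)
      with phi_pos[OF \<open>0 < a\<close>] have "0 < t" by simp
      with elim \<open>0 < a\<close> phi_less_iff[of a "phi_inv t"] show ?case
        by (simp add: phi_inv_pos phi_phi_inv)
    qed
  next
    fix a :: real assume "a < 0"
    show "eventually (\<lambda>t. a < phi_inv t) at_top"
      using eventually_gt_at_top[of 0] by eventually_elim (use phi_inv_pos \<open>a < 0\<close> in force)
  qed
qed

lemma phi_inv_tendsto_0: "(phi_inv \<longlongrightarrow> 0) at_top"
  using phi_inv_at_right_0 by (simp add: filterlim_at)

lemma mech_phi_inv_slope: "((\<lambda>t. mech (phi_inv t) / phi_inv t) \<longlongrightarrow> \<alpha>) at_top"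
  by (rule filterlim_compose[OF mech_slope_at_0 phi_inv_at_right_0])

text \<open>With \<open>v = phi_inv t\<close> the product is \<open>mech v\<close> times the integral of \<open>1 / mech\<close> over \<open>{v<..}\<close>. The part
  up to \<open>d\<close> contributes at most \<open>d\<close> since \<open>mech\<close> increases, and the part beyond \<open>d\<close> vanishes with \<open>mech v\<close>.\<close>

lemma time_mech_phi_inv: "((\<lambda>t. t * mech (phi_inv t)) \<longlongrightarrow> 0) at_top"
proof -
  have mech_0: "((\<lambda>t. mech (phi_inv t)) \<longlongrightarrow> 0) at_top"
  proof -
    have "((\<lambda>t. mech (phi_inv t) / phi_inv t * phi_inv t) \<longlongrightarrow> \<alpha> * 0) at_top"
      by (intro tendsto_mult mech_phi_inv_slope phi_inv_tendsto_0)
    then have "((\<lambda>t. mech (phi_inv t) / phi_inv t * phi_inv t) \<longlongrightarrow> 0) at_top" by simp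
    moreover have "eventually (\<lambda>t. mech (phi_inv t) / phi_inv t * phi_inv t = mech (phi_inv t)) at_top"
      using eventually_gt_at_top[of 0] by eventually_elim (use phi_inv_pos in force)
    ultimately show ?thesis by (rule Lim_transform_eventually)
  qed
  show ?thesis
  proof (rule order_tendstoI)
    fix e :: real assume "0 < e"
    define d where "d = e / 2"
    have "0 < d" using \<open>0 < e\<close> by (simp add: d_def)
    have "((\<lambda>t. phi d * mech (phi_inv t)) \<longlongrightarrow> phi d * 0) at_top"
      by (intro tendsto_intros mech_0)
    then have "eventually (\<lambda>t. phi d * mech (phi_inv t) < d) at_top"
      using \<open>0 < d\<close> by (intro order_tendstoD(2)) auto
    moreover have "eventually (\<lambda>t. phi_inv t < d) at_top"
      using phi_inv_tendsto_0 \<open>0 < d\<close> by (rule order_tendstoD(2))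
    ultimately show "eventually (\<lambda>t. t * mech (phi_inv t) < e) at_top"
      using eventually_gt_at_top[of 0]
    proof eventually_elim
      case (elim t)
      define v where "v = phi_inv t"
      have v: "0 < v" "phi v = t" using elim by (auto simp: v_def phi_inv_pos phi_phi_inv)
      have "(t - phi d) * mech v \<le> (d - v) / mech v * mech v"
        using phi_diff_le_linear[of v d] v elim mech_nonneg[of v]
        by (intro mult_right_mono) (auto simp: v_def)
      also have "\<dots> < d" using v mech_pos[of v] by simp
      finally show ?case using elim by (simp add: v_def[symmetric] d_def algebra_simps)
    qed
  next
    fix a :: real assume "a < 0"
    show "eventually (\<lambda>t. a < t * mech (phi_inv t)) at_top"
      using eventually_gt_at_top[of 0]
    proof eventually_elim
      case (elim t)
      then have "0 < t * mech (phi_inv t)" by (simp add: phi_inv_pos mech_pos)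
      with \<open>a < 0\<close> show ?case by linarith
    qed
  qed
qed

end

section \<open>One-dimensional laws of the process\<close>

context cb_process
begin

lemma mech_nonneg_at: "0 \<le> q \<Longrightarrow> 0 \<le> mech q"
  using mech_nonneg[of q] by (cases "q = 0") (auto simp: mech_eq levy_kernel_def)

lemma u_DERIV_interior:
  assumes "0 < t" "0 < q"
  shows "((\<lambda>s. u s q) has_real_derivative - mech (u t q)) (at t)"
  using u_ode[of t q] assms at_within_interior[of t "{0..}"] by simp

lemma u_continuous_on: "0 < q \<Longrightarrow> S \<subseteq> {0..} \<Longrightarrow> continuous_on S (\<lambda>s. u s q)"
  by (rule continuous_on_subset[where s="{0..}"])
     (auto intro!: DERIV_continuous_on[where D="\<lambda>t. - mech (u t q)"] u_ode)

lemma u_le: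
  assumes "0 \<le> t" "0 < q"
  shows "u t q \<le> q"
proof -
  have "u t q \<le> u 0 q"
  proof (rule DERIV_nonpos_imp_decreasing_open[OF assms(1)])
    fix x assume "0 < x" "x < t"
    with assms show "\<exists>y. ((\<lambda>s. u s q) has_real_derivative y) (at x) \<and> y \<le> 0"
      using u_DERIV_interior[of x q] mech_nonneg_at[OF u_nonneg[of x q]]
      by (intro exI[of _ "- mech (u x q)"]) simp
  qed (use assms in \<open>auto intro: u_continuous_on\<close>)
  then show ?thesis using assms by (simp add: u_start)
qed

text \<open>A solution cannot reach \<open>0\<close> in finite time because \<open>mech\<close> is at most linear below \<open>q\<close>.\<close>

lemma u_pos:
  assumes "0 \<le> t" "0 < q"
  shows "0 < u t q"
proof -
  define C where "C = mech q / q"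
  have C: "mech p \<le> C * p" if "0 \<le> p" "p \<le> q" for p
    using that mech_le_linear[of p q] by (cases "p = 0") (auto simp: C_def mech_eq levy_kernel_def)
  have "u 0 q * exp (C * 0) \<le> u t q * exp (C * t)"
  proof (rule DERIV_nonneg_imp_increasing_open[OF assms(1)])
    fix x assume x: "0 < x" "x < t"
    have "((\<lambda>s. u s q * exp (C * s)) has_real_derivative
        (C * u x q - mech (u x q)) * exp (C * x)) (at x)"
      using x assms by (auto intro!: derivative_eq_intros u_DERIV_interior simp: algebra_simps)
    moreover have "0 \<le> (C * u x q - mech (u x q)) * exp (C * x)"
      using x assms C[of "u x q"] u_nonneg[of x q] u_le[of x q] by (intro mult_nonneg_nonneg) auto
    ultimately show "\<exists>y. ((\<lambda>s. u s q * exp (C * s)) has_real_derivative y) (at x) \<and> 0 \<le> y"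
      by blast
  qed (use assms in \<open>auto intro!: continuous_intros u_continuous_on\<close>)
  then have "0 < u t q * exp (C * t)" using assms by (simp add: u_start)
  then show ?thesis by (simp add: zero_less_mult_iff)
qed

text \<open>The function \<open>phi\<close> linearises the flow: along a solution its derivative is \<open>1\<close>.\<close>

lemma phi_u:
  assumes "0 \<le> t" "0 < q"
  shows "phi (u t q) = t + phi q"
proof -
  have "\<exists>c. \<forall>s\<in>{0..}. phi (u s q) - s = c"
  proof (rule has_field_derivative_zero_constant)
    fix s :: real assume "s \<in> {0..}"
    then have s: "0 \<le> s" by simp
    then have "((\<lambda>s. phi (u s q)) has_real_derivative - (1 / mech (u s q)) * - mech (u s q))
        (at s within {0..})"
      using assms by (intro DERIV_chain2[OF phi_DERIV u_ode] u_pos)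
    then have "((\<lambda>s. phi (u s q)) has_real_derivative 1) (at s within {0..})"
      using s assms mech_pos[OF u_pos[of s q]] by simp
    from DERIV_diff[OF this DERIV_ident]
    show "((\<lambda>s. phi (u s q) - s) has_real_derivative 0) (at s within {0..})" by simp
  qed simp
  then obtain c where c: "\<And>s. 0 \<le> s \<Longrightarrow> phi (u s q) - s = c" by auto
  show ?thesis using c[of 0] c[of t] assms by (simp add: u_start)
qed

lemma u_eq_phi_inv: "0 \<le> t \<Longrightarrow> 0 < q \<Longrightarrow> u t q = phi_inv (t + phi q)"
  using phi_inv_eqI[of "u t q" "t + phi q"] by (simp add: u_pos phi_u)

lemma u_tendsto_phi_inv:
  assumes t: "0 < t"
  shows "(u t \<longlongrightarrow> phi_inv t) at_top"
proof (rule order_tendstoI)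
  fix a assume a: "a < phi_inv t"
  show "eventually (\<lambda>q. a < u t q) at_top"
  proof (cases "0 < a")
    case True
    then have "0 < phi a - t"
      using phi_less_iff[of "phi_inv t" a] a t by (simp add: phi_inv_pos phi_phi_inv)
    then have "eventually (\<lambda>q. phi q < phi a - t) at_top"
      by (intro order_tendstoD(2)[OF phi_tendsto_0])
    then show ?thesis using eventually_gt_at_top[of 0]
    proof eventually_elim
      case (elim q)
      then have "phi (u t q) < phi a" using t by (simp add: phi_u)
      then show ?case using phi_less_iff[of "u t q" a] u_pos[of t q] True t elim by simp
    qed
  next
    case False
    show ?thesis using eventually_gt_at_top[of 0]
      by eventually_elim (use False u_pos[of t] t in force)
  qed
next
  fix b assume b: "phi_inv t < b"
  show "eventually (\<lambda>q. u t q < b) at_top"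
    using eventually_gt_at_top[of 0]
  proof eventually_elim
    case (elim q)
    then show ?case using phi_inv_less[of t "t + phi q"] t b phi_pos[of q] by (simp add: u_eq_phi_inv)
  qed
qed

definition law :: "real \<Rightarrow> real \<Rightarrow> real measure" where
  "law t x = distr (P x) borel (Z t)"

lemma P_in_prob_algebra: "0 \<le> x \<Longrightarrow> P x \<in> space (prob_algebra M)"
  by (rule measurable_space[OF kernel]) (simp add: space_restrict_space)

lemma prob_space_P: "0 \<le> x \<Longrightarrow> prob_space (P x)"
  using P_in_prob_algebra[of x] by (simp add: space_prob_algebra)

lemma sets_P: "0 \<le> x \<Longrightarrow> sets (P x) = sets M"
  using P_in_prob_algebra[of x] by (simp add: space_prob_algebra)

lemma Z_measurable_P: "0 \<le> x \<Longrightarrow> 0 \<le> t \<Longrightarrow> Z t \<in> borel_measurable (P x)"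
  using Z_measurable[of t] measurable_cong_sets[OF sets_P[of x] refl, of borel] by blast

lemma prob_space_law: "0 \<le> x \<Longrightarrow> 0 \<le> t \<Longrightarrow> prob_space (law t x)"
  unfolding law_def by (intro prob_space.prob_space_distr prob_space_P Z_measurable_P)

lemma sets_law [simp, measurable_cong]: "sets (law t x) = sets borel"
  by (simp add: law_def)

lemma space_law [simp]: "space (law t x) = UNIV"
  by (simp add: law_def)

lemma AE_law_nonneg:
  assumes "0 \<le> x" "0 \<le> t"
  shows "AE y in law t x. 0 \<le> y"
proof -
  have "AE w in P x. 0 \<le> Z t w"
    using Z_nonneg[OF assms(2)] sets_eq_imp_space_eq[OF sets_P[OF assms(1)]] by (intro AE_I2) simp
  then show ?thesis
    unfolding law_def by (subst AE_distr_iff[OF Z_measurable_P[OF assms]]) simp_all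
qed

lemma law_kernel:
  assumes "0 \<le> t"
  shows "(\<lambda>x. law t (max 0 x)) \<in> borel \<rightarrow>\<^sub>M subprob_algebra borel"
proof -
  \<comment> \<open>The kernel is only controlled at nonnegative initial values.\<close>
  have "(\<lambda>x::real. max 0 x) \<in> borel \<rightarrow>\<^sub>M restrict_space borel {0..}"
    by (intro measurable_restrict_space2) auto
  from measurable_compose[OF this kernel]
  have "(\<lambda>x. P (max 0 x)) \<in> borel \<rightarrow>\<^sub>M subprob_algebra M"
    by (rule measurable_prob_algebraD)
  from measurable_compose[OF this measurable_distr[OF Z_measurable[OF assms]]]
  show ?thesis by (simp add: law_def)
qed

lemma law_laplace_integral:
  assumes "0 \<le> x" "0 \<le> t" "0 < q"
  shows "(\<integral>y. exp (- q * y) \<partial>law t x) = exp (- x * u t q)"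
  unfolding law_def using Z_laplace[OF assms]
  by (subst integral_distr[OF Z_measurable_P[OF assms(1,2)]]) simp_all

lemma law_laplace:
  assumes "0 \<le> x" "0 \<le> t" "0 < q"
  shows "(\<integral>\<^sup>+y. ennreal (exp (- q * y)) \<partial>law t x) = ennreal (exp (- x * u t q))"
proof -
  interpret prob_space "law t x" using assms by (intro prob_space_law)
  have "integrable (law t x) (\<lambda>y. exp (- q * y))"
    using AE_law_nonneg[of x t] assms
    by (intro integrable_const_bound[where B=1]) (auto elim!: eventually_mono)
  then show ?thesis
    using law_laplace_integral[OF assms] by (subst nn_integral_eq_integral) auto
qed

text \<open>Letting the Laplace variable tend to infinity isolates the mass at \<open>0\<close>.\<close>

lemma law_extinct:
  assumes "0 \<le> x" "0 < t"
  shows "emeasure (law t x) {0} = ennreal (exp (- x * phi_inv t))"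
proof -
  have t: "0 \<le> t" using assms by simp
  interpret prob_space "law t x" using assms by (intro prob_space_law) auto
  have "(\<lambda>k. \<integral>y. exp (- real (Suc k) * y) \<partial>law t x) \<longlonglongrightarrow> (\<integral>y. indicator {0} y \<partial>law t x)"
  proof (rule integral_dominated_convergence[where w="\<lambda>_. 1"])
    show "AE y in law t x. (\<lambda>k. exp (- real (Suc k) * y)) \<longlonglongrightarrow> indicator {0} y"
      using AE_law_nonneg[OF assms(1) t]
    proof eventually_elim
      case (elim y)
      show ?case
      proof (cases "y = 0")
        case False
        with elim have "exp (- y) < 1" "0 \<le> exp (- y)" by auto
        then have "(\<lambda>k. exp (- y) ^ Suc k) \<longlonglongrightarrow> 0"
          by (intro LIMSEQ_Suc LIMSEQ_realpow_zero) auto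
        moreover have "exp (- real (Suc k) * y) = exp (- y) ^ Suc k" for k
          using exp_of_nat_mult[of "Suc k" "- y"] by (simp only: mult_minus_left mult_minus_right)
        ultimately show ?thesis using False by simp
      qed simp
    qed
    show "AE y in law t x. norm (exp (- real (Suc k) * y)) \<le> 1" for k
      using AE_law_nonneg[OF assms(1) t] by eventually_elim (simp add: mult_nonneg_nonneg del: of_nat_Suc)
    show "integrable (law t x) (\<lambda>_. 1::real)" by (rule integrable_const)
    show "(indicator {0} :: real \<Rightarrow> real) \<in> borel_measurable (law t x)" by measurable
    show "(\<lambda>y. exp (- real (Suc k) * y)) \<in> borel_measurable (law t x)" for k by measurable
  qed
  also have "(\<lambda>k. \<integral>y. exp (- real (Suc k) * y) \<partial>law t x) = (\<lambda>k. exp (- x * u t (real (Suc k))))"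
    by (rule ext, rule law_laplace_integral[OF assms(1) t]) simp
  also have "(\<integral>y. indicator {0} y \<partial>law t x) = measure (law t x) {0}" by simp
  finally have 1: "(\<lambda>k. exp (- x * u t (real (Suc k)))) \<longlonglongrightarrow> measure (law t x) {0}" .
  have "(\<lambda>k. u t (real (Suc k))) \<longlonglongrightarrow> phi_inv t"
    by (rule filterlim_compose[OF u_tendsto_phi_inv[OF assms(2)]
        filterlim_compose[OF filterlim_real_sequentially filterlim_Suc]])
  then have "(\<lambda>k. exp (- x * u t (real (Suc k)))) \<longlonglongrightarrow> exp (- x * phi_inv t)"
    by (intro tendsto_exp tendsto_mult tendsto_const)
  with 1 have "measure (law t x) {0} = exp (- x * phi_inv t)"
    by (rule LIMSEQ_unique)
  then show ?thesis by (simp add: emeasure_eq_measure)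
qed

lemma law_alive:
  assumes "0 \<le> x" "0 < t"
  shows "emeasure (law t x) {0<..} = ennreal (1 - exp (- x * phi_inv t))"
proof -
  have t: "0 \<le> t" using assms by simp
  interpret prob_space "law t x" using assms by (intro prob_space_law) auto
  have "measure (law t x) {0<..} = measure (law t x) (space (law t x) - {0})"
    using AE_law_nonneg[OF assms(1) t] by (intro measure_eq_AE) (auto elim!: eventually_mono)
  also have "\<dots> = 1 - measure (law t x) {0}" by (subst prob_compl) auto
  also have "measure (law t x) {0} = exp (- x * phi_inv t)"
    using law_extinct[OF assms] by (simp add: emeasure_eq_measure)
  finally show ?thesis by (simp add: emeasure_eq_measure)
qed

text \<open>The branching property: the transform of the law is multiplicative in the initial value.\<close>

lemma law_convolution:
  assumes "0 \<le> x" "0 \<le> y" "0 \<le> t"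
  shows "law t (x + y) = (law t x \<star> law t y)"
proof (rule laplace_unique)
  interpret X: prob_space "law t x" using assms by (intro prob_space_law)
  interpret Y: prob_space "law t y" using assms by (intro prob_space_law)
  show "AE z in law t (x + y). 0 \<le> z" using assms by (intro AE_law_nonneg) auto
  show "sets (law t x \<star> law t y) = sets borel" by simp
  have conv: "(\<integral>\<^sup>+z. f z \<partial>(law t x \<star> law t y)) = (\<integral>\<^sup>+a. \<integral>\<^sup>+b. f (a + b) \<partial>law t y \<partial>law t x)"
    if "f \<in> borel_measurable borel" for f
    by (rule nn_integral_convolution[OF X.finite_measure_axioms Y.finite_measure_axioms _ _ that])
       (rule sets_law)+
  have "(\<integral>\<^sup>+z. indicator {..<0} z \<partial>(law t x \<star> law t y)) =
      (\<integral>\<^sup>+a. \<integral>\<^sup>+b. indicator {..<0} (a + b) \<partial>law t y \<partial>law t x)"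
    by (intro conv) simp
  also have "\<dots> = (\<integral>\<^sup>+a. \<integral>\<^sup>+b. 0 \<partial>law t y \<partial>law t x)"
  proof (rule nn_integral_cong_AE)
    show "AE a in law t x. (\<integral>\<^sup>+b. indicator {..<0} (a + b) \<partial>law t y) = (\<integral>\<^sup>+b. 0 \<partial>law t y)"
      using AE_law_nonneg[OF assms(1,3)]
    proof eventually_elim
      case (elim a)
      show ?case
      proof (rule nn_integral_cong_AE)
        show "AE b in law t y. indicator {..<0} (a + b) = (0::ennreal)"
          using AE_law_nonneg[OF assms(2,3)] by eventually_elim (use elim in simp)
      qed
    qed
  qed
  finally have "emeasure (law t x \<star> law t y) {..<0} = 0" by simp
  then show "AE z in (law t x \<star> law t y). 0 \<le> z"
    by (intro AE_I[where N="{..<0}"]) auto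
  fix q :: real assume q: "0 < q"
  have xy: "(\<integral>\<^sup>+z. ennreal (exp (- q * z)) \<partial>law t (x + y)) = ennreal (exp (- (x + y) * u t q))"
    using assms q by (intro law_laplace) auto
  then show "(\<integral>\<^sup>+z. ennreal (exp (- q * z)) \<partial>law t (x + y)) < \<infinity>" by simp
  have "(\<integral>\<^sup>+z. ennreal (exp (- q * z)) \<partial>(law t x \<star> law t y)) =
      (\<integral>\<^sup>+a. \<integral>\<^sup>+b. ennreal (exp (- q * (a + b))) \<partial>law t y \<partial>law t x)"
    by (intro conv) simp
  also have "\<dots> = (\<integral>\<^sup>+a. \<integral>\<^sup>+b. ennreal (exp (- q * a)) * ennreal (exp (- q * b)) \<partial>law t y \<partial>law t x)"
    by (intro nn_integral_cong) (simp add: ennreal_mult[symmetric] exp_add[symmetric] distrib_left)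
  also have "\<dots> = (\<integral>\<^sup>+a. ennreal (exp (- q * a)) * (\<integral>\<^sup>+b. ennreal (exp (- q * b)) \<partial>law t y) \<partial>law t x)"
    by (intro nn_integral_cong nn_integral_cmult) simp
  also have "\<dots> = (\<integral>\<^sup>+a. ennreal (exp (- q * a)) \<partial>law t x) * (\<integral>\<^sup>+b. ennreal (exp (- q * b)) \<partial>law t y)"
    by (intro nn_integral_multc) simp
  also have "\<dots> = ennreal (exp (- x * u t q)) * ennreal (exp (- y * u t q))"
    by (simp only: law_laplace[OF assms(1,3) q] law_laplace[OF assms(2,3) q])
  also have "\<dots> = ennreal (exp (- (x + y) * u t q))"
    by (simp add: ennreal_mult[symmetric] exp_add[symmetric] left_diff_distrib)
  finally show "(\<integral>\<^sup>+z. ennreal (exp (- q * z)) \<partial>law t (x + y)) =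
      (\<integral>\<^sup>+z. ennreal (exp (- q * z)) \<partial>(law t x \<star> law t y))"
    by (simp only: xy)
qed (rule sets_law)

end

section \<open>Comparison of initial values\<close>

context cb_process
begin

text \<open>Integrals are kept in the extended nonnegative reals because test functions need not be
  integrable against the limit measure.\<close>

definition alive_integral :: "real \<Rightarrow> real \<Rightarrow> (real \<Rightarrow> ennreal) \<Rightarrow> ennreal" where
  "alive_integral t x h = (\<integral>\<^sup>+y. h y * indicator {0<..} y \<partial>law t x)"

lemma alive_integral_mono: "(\<And>y. 0 < y \<Longrightarrow> g y \<le> h y) \<Longrightarrow> alive_integral t x g \<le> alive_integral t x h"
  unfolding alive_integral_def by (intro nn_integral_mono) (auto split: split_indicator)

lemma alive_integral_add:
  assumes [measurable]: "g \<in> borel_measurable borel" "h \<in> borel_measurable borel"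
  shows "alive_integral t x (\<lambda>y. g y + h y) = alive_integral t x g + alive_integral t x h"
  unfolding alive_integral_def by (subst nn_integral_add[symmetric]) (simp_all add: distrib_right)

lemma alive_integral_exp:
  assumes "0 \<le> x" "0 < t" "0 < q"
  shows "alive_integral t x (\<lambda>y. ennreal (exp (- q * y))) + ennreal (exp (- x * phi_inv t)) =
    ennreal (exp (- x * u t q))"
proof -
  have t: "0 \<le> t" using assms by simp
  have "ennreal (exp (- x * u t q)) = (\<integral>\<^sup>+y. ennreal (exp (- q * y)) \<partial>law t x)"
    by (rule law_laplace[symmetric, OF assms(1) t assms(3)])
  also have "\<dots> = (\<integral>\<^sup>+y. ennreal (exp (- q * y)) * indicator {0<..} y + indicator {0} y \<partial>law t x)"
  proof (rule nn_integral_cong_AE)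
    show "AE y in law t x. ennreal (exp (- q * y)) =
        ennreal (exp (- q * y)) * indicator {0<..} y + indicator {0} y"
      using AE_law_nonneg[OF assms(1) t] by eventually_elim (auto split: split_indicator)
  qed
  also have "\<dots> = alive_integral t x (\<lambda>y. ennreal (exp (- q * y))) + emeasure (law t x) {0}"
    unfolding alive_integral_def by (subst nn_integral_add) auto
  finally show ?thesis by (simp add: law_extinct[OF assms(1,2)])
qed

lemma alive_integral_one:
  assumes "0 \<le> x" "0 < t"
  shows "alive_integral t x (\<lambda>_. 1) = ennreal (1 - exp (- x * phi_inv t))"
  unfolding alive_integral_def by (simp add: law_alive[OF assms])

lemma alive_integral_convolution:
  assumes "0 \<le> x" "0 \<le> y" "0 \<le> t" and [measurable]: "h \<in> borel_measurable borel"
  shows "alive_integral t (x + y) h =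
    (\<integral>\<^sup>+a. \<integral>\<^sup>+b. h (a + b) * indicator {0<..} (a + b) \<partial>law t y \<partial>law t x)"
proof -
  interpret X: prob_space "law t x" using assms by (intro prob_space_law)
  interpret Y: prob_space "law t y" using assms by (intro prob_space_law)
  show ?thesis
    unfolding alive_integral_def law_convolution[OF assms(1-3)]
    by (rule nn_integral_convolution[OF X.finite_measure_axioms Y.finite_measure_axioms])
       (rule sets_law, rule sets_law, measurable)
qed

text \<open>Two independent populations with initial values \<open>x\<close> and \<open>y\<close> are considered on the disjoint
  events that exactly one of them is extinct.\<close>

lemma alive_integral_superadditive:
  assumes "0 \<le> x" "0 \<le> y" "0 < t" and h [measurable]: "h \<in> borel_measurable borel"
  shows "ennreal (exp (- y * phi_inv t)) * alive_integral t x h +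
      ennreal (exp (- x * phi_inv t)) * alive_integral t y h \<le> alive_integral t (x + y) h"
proof -
  have t: "0 \<le> t" using assms by simp
  define H where "H a = h a * indicator {0<..} a" for a
  have [measurable]: "H \<in> borel_measurable borel" unfolding H_def by measurable
  have T: "alive_integral t z h = (\<integral>\<^sup>+a. H a \<partial>law t z)" for z
    by (simp add: alive_integral_def H_def)
  have "(\<integral>\<^sup>+b. H a * indicator {0} b + indicator {0} a * H b \<partial>law t y) =
      H a * ennreal (exp (- y * phi_inv t)) + indicator {0} a * alive_integral t y h" for a
    by (subst nn_integral_add) (simp_all add: nn_integral_cmult law_extinct[OF assms(2,3)] T)
  then have "ennreal (exp (- y * phi_inv t)) * alive_integral t x h +
      ennreal (exp (- x * phi_inv t)) * alive_integral t y h =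
      (\<integral>\<^sup>+a. \<integral>\<^sup>+b. H a * indicator {0} b + indicator {0} a * H b \<partial>law t y \<partial>law t x)"
    by (subst nn_integral_cong, assumption, subst nn_integral_add)
       (simp_all add: nn_integral_multc law_extinct[OF assms(1,3)] T mult.commute)
  also have "\<dots> \<le> (\<integral>\<^sup>+a. \<integral>\<^sup>+b. h (a + b) * indicator {0<..} (a + b) \<partial>law t y \<partial>law t x)"
    by (intro nn_integral_mono) (auto simp: H_def split: split_indicator)
  also have "\<dots> = alive_integral t (x + y) h"
    by (rule alive_integral_convolution[symmetric, OF assms(1,2) t h])
  finally show ?thesis .
qed

text \<open>Superadditivity iterated over \<open>n\<close> copies of \<open>x\<close>; the exponential factor records the extinction of
  everything outside one copy.\<close>

lemma alive_integral_multiples: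
  assumes x: "0 < x" and t: "0 < t" and h: "h \<in> borel_measurable borel"
  shows "real n * x \<le> y \<Longrightarrow>
    ennreal (real n * exp (- (y - x) * phi_inv t)) * alive_integral t x h \<le> alive_integral t y h"
proof (induction n arbitrary: y)
  case (Suc n)
  define v where "v = phi_inv t"
  define z where "z = y - x"
  have nz: "real n * x \<le> z" using Suc.prems by (simp add: z_def algebra_simps)
  moreover have "0 \<le> real n * x" using x by simp
  ultimately have z: "0 \<le> z" by linarith
  have "ennreal (real (Suc n) * exp (- z * v)) * alive_integral t x h =
      ennreal (exp (- x * v)) * (ennreal (real n * exp (- (z - x) * v)) * alive_integral t x h) +
      ennreal (exp (- z * v)) * alive_integral t x h"
  proof -
    have "ennreal (real (Suc n) * exp (- z * v)) =
        ennreal (exp (- x * v)) * ennreal (real n * exp (- (z - x) * v)) + ennreal (exp (- z * v))"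
    proof -
      have "exp (- x * v) * exp (- (z - x) * v) = exp (- z * v)"
        by (simp add: exp_add[symmetric] algebra_simps)
      then have "real (Suc n) * exp (- z * v) = exp (- x * v) * (real n * exp (- (z - x) * v)) + exp (- z * v)"
        by (simp add: algebra_simps)
      then show ?thesis by (simp add: ennreal_mult[symmetric] ennreal_plus[symmetric] del: ennreal_plus of_nat_Suc)
    qed
    then show ?thesis by (simp add: distrib_right mult.assoc)
  qed
  also have "\<dots> \<le> ennreal (exp (- x * v)) * alive_integral t z h + ennreal (exp (- z * v)) * alive_integral t x h"
    using Suc.IH[OF nz] by (intro add_right_mono mult_left_mono) (simp_all add: v_def)
  also have "\<dots> \<le> alive_integral t (z + x) h"
    unfolding v_def using z x t h by (intro alive_integral_superadditive) auto
  finally show ?case by (simp add: z_def v_def)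
qed simp

lemma alive_integral_linear_lower:
  assumes x: "0 < x" and y: "0 \<le> y" and t: "0 < t" and h: "h \<in> borel_measurable borel"
  shows "ennreal ((y / x - 1) * exp (- y * phi_inv t)) * alive_integral t x h \<le> alive_integral t y h"
proof -
  \<comment> \<open>The number of copies of \<open>x\<close> that fit into \<open>y\<close>.\<close>
  define n where "n = nat \<lfloor>y / x\<rfloor>"
  have pos: "0 \<le> y / x" using x y by simp
  have n: "real n \<le> y / x" "y / x - 1 \<le> real n"
    using pos by (auto simp: n_def)
  have "(y / x - 1) * exp (- y * phi_inv t) \<le> real n * exp (- (y - x) * phi_inv t)"
    using n(2) mult_right_mono[of "y - x" y "phi_inv t"] x phi_inv_pos[OF t]
    by (intro mult_mono) (auto simp: algebra_simps)
  then have "ennreal ((y / x - 1) * exp (- y * phi_inv t)) * alive_integral t x h \<le>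
      ennreal (real n * exp (- (y - x) * phi_inv t)) * alive_integral t x h"
    by (intro mult_right_mono ennreal_leI) auto
  also have "\<dots> \<le> alive_integral t y h"
    using n(1) x by (intro alive_integral_multiples[OF x t h]) (simp add: field_simps)
  finally show ?thesis .
qed

text \<open>Upper bound: for test functions below \<open>1\<close> the additivity defect is at most the probability
  that both populations are alive.\<close>

lemma alive_integral_subadditive:
  assumes "0 \<le> x" "0 \<le> y" "0 < t" and h [measurable]: "h \<in> borel_measurable borel"
    and h1: "\<And>z. h z \<le> 1"
  shows "alive_integral t (x + y) h \<le>
    alive_integral t x h + alive_integral t y h + ennreal (x * y * (phi_inv t)\<^sup>2)"
proof -
  have t: "0 \<le> t" using assms by simp
  interpret X: prob_space "law t x" using assms t by (intro prob_space_law)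
  interpret Y: prob_space "law t y" using assms t by (intro prob_space_law)
  define H where "H a = h a * indicator {0<..} a" for a
  have [measurable]: "H \<in> borel_measurable borel" unfolding H_def by measurable
  have T: "alive_integral t z h = (\<integral>\<^sup>+a. H a \<partial>law t z)" for z
    by (simp add: alive_integral_def H_def)
  define p where "p z = emeasure (law t z) {0<..}" for z
  have p: "p z \<le> ennreal (z * phi_inv t)" if "0 \<le> z" for z
    using exp_ge_add_one_self[of "- z * phi_inv t"] law_alive[OF that \<open>0 < t\<close>]
    by (auto simp: p_def intro!: ennreal_leI)
  have "alive_integral t (x + y) h =
      (\<integral>\<^sup>+a. \<integral>\<^sup>+b. h (a + b) * indicator {0<..} (a + b) \<partial>law t y \<partial>law t x)"
    by (rule alive_integral_convolution[OF assms(1,2) t h])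
  also have "\<dots> \<le> (\<integral>\<^sup>+a. \<integral>\<^sup>+b. H a + H b + indicator {0<..} a * indicator {0<..} b \<partial>law t y \<partial>law t x)"
  proof (rule nn_integral_mono_AE)
    show "AE a in law t x. (\<integral>\<^sup>+b. h (a + b) * indicator {0<..} (a + b) \<partial>law t y) \<le>
        (\<integral>\<^sup>+b. H a + H b + indicator {0<..} a * indicator {0<..} b \<partial>law t y)"
      using AE_law_nonneg[OF assms(1) t]
    proof eventually_elim
      case (elim a)
      show ?case
      proof (rule nn_integral_mono_AE)
        show "AE b in law t y. h (a + b) * indicator {0<..} (a + b) \<le>
            H a + H b + indicator {0<..} a * indicator {0<..} b"
          using AE_law_nonneg[OF assms(2) t]
        proof eventually_elim
          case (elim b)
          have "h (a + b) \<le> h a + h b + 1" using h1[of "a + b"] by (rule order_trans) simp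
          with elim \<open>0 \<le> a\<close> show ?case
            by (cases "a = 0"; cases "b = 0") (auto simp: H_def split: split_indicator)
        qed
      qed
    qed
  qed
  also have "\<dots> = (\<integral>\<^sup>+a. H a + (alive_integral t y h + indicator {0<..} a * p y) \<partial>law t x)"
  proof (rule nn_integral_cong)
    fix a
    have "(\<integral>\<^sup>+b. H a + H b + indicator {0<..} a * indicator {0<..} b \<partial>law t y) =
        (\<integral>\<^sup>+b. H a + H b \<partial>law t y) + (\<integral>\<^sup>+b. indicator {0<..} a * indicator {0<..} b \<partial>law t y)"
      by (rule nn_integral_add) measurable
    also have "(\<integral>\<^sup>+b. H a + H b \<partial>law t y) = (\<integral>\<^sup>+b. H a \<partial>law t y) + (\<integral>\<^sup>+b. H b \<partial>law t y)"
      by (rule nn_integral_add) measurable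
    also have "(\<integral>\<^sup>+b. H a \<partial>law t y) = H a" using Y.emeasure_space_1 by simp
    also have "(\<integral>\<^sup>+b. indicator {0<..} a * indicator {0<..} b \<partial>law t y) = indicator {0<..} a * p y"
      by (subst nn_integral_cmult) (simp_all add: p_def)
    finally show "(\<integral>\<^sup>+b. H a + H b + indicator {0<..} a * indicator {0<..} b \<partial>law t y) =
        H a + (alive_integral t y h + indicator {0<..} a * p y)" by (simp add: T add.assoc)
  qed
  also have "\<dots> = alive_integral t x h + (alive_integral t y h + p x * p y)"
  proof -
    have "(\<integral>\<^sup>+a. H a + (alive_integral t y h + indicator {0<..} a * p y) \<partial>law t x) =
        (\<integral>\<^sup>+a. H a \<partial>law t x) + (\<integral>\<^sup>+a. alive_integral t y h + indicator {0<..} a * p y \<partial>law t x)"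
      by (rule nn_integral_add) measurable
    also have "(\<integral>\<^sup>+a. alive_integral t y h + indicator {0<..} a * p y \<partial>law t x) =
        (\<integral>\<^sup>+a. alive_integral t y h \<partial>law t x) + (\<integral>\<^sup>+a. indicator {0<..} a * p y \<partial>law t x)"
      by (rule nn_integral_add) measurable
    also have "(\<integral>\<^sup>+a. alive_integral t y h \<partial>law t x) = alive_integral t y h"
      using X.emeasure_space_1 by simp
    also have "(\<integral>\<^sup>+a. indicator {0<..} a * p y \<partial>law t x) = p x * p y"
      by (subst nn_integral_multc) (simp_all add: p_def)
    finally show ?thesis by (simp add: T)
  qed
  also have "\<dots> \<le> alive_integral t x h + (alive_integral t y h + ennreal (x * y * (phi_inv t)\<^sup>2))"
  proof -
    have "p x * p y \<le> ennreal (x * phi_inv t) * ennreal (y * phi_inv t)"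
      using p assms by (intro mult_mono) auto
    also have "\<dots> = ennreal (x * y * (phi_inv t)\<^sup>2)"
      using assms phi_inv_pos[of t] by (simp add: ennreal_mult[symmetric] power2_eq_square ac_simps)
    finally show ?thesis by (intro add_left_mono)
  qed
  finally show ?thesis by (simp add: add.assoc)
qed

text \<open>The defects of the successive splittings add up to at most the square of \<open>n * x * phi_inv t\<close>, which
  depends on \<open>n\<close> and \<open>x\<close> only through the total initial value.\<close>

lemma alive_integral_subdivide:
  assumes x: "0 \<le> x" and t: "0 < t" and h: "h \<in> borel_measurable borel" and h1: "\<And>z. h z \<le> 1"
  shows "alive_integral t (real n * x) h \<le>
    of_nat n * alive_integral t x h + ennreal ((real n * x * phi_inv t)\<^sup>2)"
proof (induction n)
  case 0
  have "alive_integral t 0 h \<le> alive_integral t 0 (\<lambda>_. 1)"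
    using h1 by (intro alive_integral_mono) auto
  also have "\<dots> = 0" using alive_integral_one[of 0 t] t by simp
  finally show ?case by simp
next
  case (Suc n)
  define v where "v = phi_inv t"
  have "alive_integral t (real (Suc n) * x) h = alive_integral t (real n * x + x) h"
    by (simp add: algebra_simps)
  also have "\<dots> \<le> alive_integral t (real n * x) h + alive_integral t x h + ennreal (real n * x * x * v\<^sup>2)"
    unfolding v_def using x t h h1 by (intro alive_integral_subadditive) auto
  also have "\<dots> \<le> (of_nat n * alive_integral t x h + ennreal ((real n * x * v)\<^sup>2)) +
      alive_integral t x h + ennreal (real n * x * x * v\<^sup>2)"
    using Suc.IH by (intro add_right_mono) (simp add: v_def)
  also have "\<dots> = of_nat (Suc n) * alive_integral t x h +
      (ennreal ((real n * x * v)\<^sup>2) + ennreal (real n * x * x * v\<^sup>2))"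
    by (simp add: distrib_right ac_simps)
  also have "ennreal ((real n * x * v)\<^sup>2) + ennreal (real n * x * x * v\<^sup>2) =
      ennreal ((real n * x * v)\<^sup>2 + real n * x * x * v\<^sup>2)"
    using x by (intro ennreal_plus[symmetric]) auto
  also have "\<dots> \<le> ennreal ((real (Suc n) * x * v)\<^sup>2)"
  proof (rule ennreal_leI)
    have "(real (Suc n) * x * v)\<^sup>2 = ((real n)\<^sup>2 + 2 * real n + 1) * (x\<^sup>2 * v\<^sup>2)"
      by (simp add: power2_eq_square algebra_simps)
    moreover have "(real n * x * v)\<^sup>2 + real n * x * x * v\<^sup>2 = ((real n)\<^sup>2 + real n) * (x\<^sup>2 * v\<^sup>2)"
      by (simp add: power2_eq_square algebra_simps)
    ultimately show "(real n * x * v)\<^sup>2 + real n * x * x * v\<^sup>2 \<le> (real (Suc n) * x * v)\<^sup>2"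
      by (simp add: mult_right_mono)
  qed
  finally show ?case by (simp add: v_def)
qed

end

section \<open>The quasi-invariant limit measure\<close>

text \<open>The integral of \<open>exp (- \<alpha> * r)\<close> over \<open>0 \<le> r \<le> s\<close>, which is the Laplace transform of the limit
  measure read on the scale \<open>s = phi q\<close>. It allows the cases \<open>\<alpha> = 0\<close> and \<open>\<alpha> > 0\<close> to be treated together.\<close>

definition discounted_time :: "real \<Rightarrow> real \<Rightarrow> real" where
  "discounted_time \<alpha> s = (if \<alpha> = 0 then s else (1 - exp (- \<alpha> * s)) / \<alpha>)"

lemma discounted_time_DERIV:
  "(discounted_time \<alpha> has_real_derivative exp (- \<alpha> * s)) (at s)"
  unfolding discounted_time_def
  by (cases "\<alpha> = 0") (auto intro!: derivative_eq_intros)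

lemma discounted_time_add:
  "discounted_time \<alpha> (s + t) = discounted_time \<alpha> t + exp (- \<alpha> * t) * discounted_time \<alpha> s"
  by (auto simp: discounted_time_def field_simps exp_add[symmetric] exp_diff exp_minus)

lemma discounted_time_nonneg: "0 \<le> \<alpha> \<Longrightarrow> 0 \<le> s \<Longrightarrow> 0 \<le> discounted_time \<alpha> s"
  by (auto simp: discounted_time_def)

text \<open>The transform determines \<open>m\<close>. It is the Yaglom distribution divided by \<open>\<alpha>\<close> if \<open>\<alpha> > 0\<close>, and
  \<open>W y / y dy\<close> if \<open>\<alpha> = 0\<close>.\<close>

locale cb_limit_measure = cb_process \<alpha> \<sigma> \<pi> M P Z u
  for \<alpha> \<sigma> :: real and \<pi> :: "real measure" and M :: "'w measure" and P :: "real \<Rightarrow> 'w measure"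
    and Z :: "real \<Rightarrow> 'w \<Rightarrow> real" and u :: "real \<Rightarrow> real \<Rightarrow> real" +
  fixes m :: "real measure"
  assumes sets_m [measurable_cong]: "sets m = sets borel"
    and AE_m_pos: "AE y in m. 0 < y"
    and laplace_m: "\<And>q. 0 < q \<Longrightarrow>
      (\<integral>\<^sup>+y. ennreal (exp (- q * y)) \<partial>m) = ennreal (discounted_time \<alpha> (ext_time (branching_mech \<alpha> \<sigma> \<pi>) q))"
begin

abbreviation dtime :: "real \<Rightarrow> real" where
  "dtime \<equiv> discounted_time \<alpha>"

lemma dtime_nonneg: "0 \<le> s \<Longrightarrow> 0 \<le> dtime s"
  by (rule discounted_time_nonneg[OF alpha_nonneg])

text \<open>For \<open>h y = exp (- q * y)\<close> the left-hand side is the transform of \<open>m\<close> at \<open>u t q\<close> minus the one at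
  \<open>phi_inv t\<close>, that is \<open>dtime (phi q + t) - dtime t = exp (- \<alpha> * t) * dtime (phi q)\<close>. Uniqueness of the
  Laplace transform extends this to all \<open>h\<close>. The maximum in the initial value matters only on the
  null set of nonpositive \<open>x\<close> and makes the kernel total.\<close>

lemma quasi_invariant:
  assumes t: "0 < t" and h [measurable]: "h \<in> borel_measurable borel"
  shows "(\<integral>\<^sup>+x. alive_integral t (max 0 x) h \<partial>m) = ennreal (exp (- \<alpha> * t)) * (\<integral>\<^sup>+y. h y \<partial>m)"
proof -
  have t0: "0 \<le> t" using t by simp
  define K where "K x = law t (max 0 x)" for x
  have K: "K \<in> m \<rightarrow>\<^sub>M subprob_algebra borel"
    using law_kernel[OF t0] measurable_cong_sets[OF sets_m refl] unfolding K_def by blast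
  have space_m: "space m \<noteq> {}" using sets_eq_imp_space_eq[OF sets_m] by simp
  define R where "R = density (m \<bind> K) (indicator {0<..})"
  define S where "S = density m (\<lambda>_. ennreal (exp (- \<alpha> * t)))"
  have sets_bind: "sets (m \<bind> K) = sets borel"
    by (rule sets_bind_measurable[OF K space_m])
  have int_R: "(\<integral>\<^sup>+y. g y \<partial>R) = (\<integral>\<^sup>+x. alive_integral t (max 0 x) g \<partial>m)"
    if [measurable]: "g \<in> borel_measurable borel" for g
  proof -
    note sets_bind[measurable_cong]
    have "(\<integral>\<^sup>+y. g y \<partial>R) = (\<integral>\<^sup>+y. indicator {0<..} y * g y \<partial>(m \<bind> K))"
      unfolding R_def by (rule nn_integral_density) measurable
    also have "\<dots> = (\<integral>\<^sup>+x. \<integral>\<^sup>+y. indicator {0<..} y * g y \<partial>K x \<partial>m)"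
      by (rule nn_integral_bind[OF _ K]) measurable
    finally show ?thesis by (simp add: alive_integral_def K_def mult.commute)
  qed
  have int_S: "(\<integral>\<^sup>+y. g y \<partial>S) = ennreal (exp (- \<alpha> * t)) * (\<integral>\<^sup>+y. g y \<partial>m)"
    if [measurable]: "g \<in> borel_measurable borel" for g
    unfolding S_def by (subst nn_integral_density) (auto intro!: nn_integral_cmult)
  have alive_meas: "(\<lambda>x. alive_integral t (max 0 x) g) \<in> borel_measurable m"
    if "g \<in> borel_measurable borel" for g
  proof -
    have "(\<lambda>y. g y * indicator {0<..} y) \<in> borel_measurable borel" using that by measurable
    from measurable_compose[OF K nn_integral_measurable_subprob_algebra[OF this]]
    show ?thesis by (simp add: alive_integral_def K_def)
  qed
  have "R = S"
  proof (rule laplace_unique)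
    show "sets R = sets borel" "sets S = sets borel"
      by (simp_all add: R_def S_def sets_bind sets_m)
    have "AE y in m \<bind> K. 0 < (indicator {0<..} y :: ennreal) \<longrightarrow> (0::real) \<le> y"
      by (rule AE_I2) (auto split: split_indicator)
    then show "AE y in R. 0 \<le> y"
      unfolding R_def using sets_bind by (subst AE_density) (auto cong: measurable_cong_sets)
    have "AE y in m. 0 < ennreal (exp (- \<alpha> * t)) \<longrightarrow> 0 \<le> y"
      using AE_m_pos by eventually_elim simp
    then show "AE y in S. 0 \<le> y" unfolding S_def by (subst AE_density) auto
    fix q :: real assume q: "0 < q"
    have uq: "0 < u t q" by (rule u_pos[OF t0 q])
    let ?e = "\<lambda>y. ennreal (exp (- q * y))"
    have "(\<integral>\<^sup>+x. alive_integral t (max 0 x) ?e \<partial>m) + (\<integral>\<^sup>+x. ennreal (exp (- phi_inv t * x)) \<partial>m) =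
        (\<integral>\<^sup>+x. alive_integral t (max 0 x) ?e + ennreal (exp (- phi_inv t * x)) \<partial>m)"
      by (rule nn_integral_add[symmetric]) (auto intro: alive_meas)
    also have "\<dots> = (\<integral>\<^sup>+x. ennreal (exp (- u t q * x)) \<partial>m)"
    proof (rule nn_integral_cong_AE)
      show "AE x in m. alive_integral t (max 0 x) ?e + ennreal (exp (- phi_inv t * x)) =
          ennreal (exp (- u t q * x))"
        using AE_m_pos
      proof eventually_elim
        case (elim x)
        then show ?case using alive_integral_exp[of x t q] t q by (simp add: mult.commute)
      qed
    qed
    finally have "(\<integral>\<^sup>+x. alive_integral t (max 0 x) ?e \<partial>m) + ennreal (dtime t) = ennreal (dtime (phi q + t))"
      using laplace_m[OF uq] laplace_m[OF phi_inv_pos[OF t]]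
      by (simp add: phi_u[OF t0 q] phi_phi_inv[OF t] add.commute)
    also have "\<dots> = ennreal (exp (- \<alpha> * t) * dtime (phi q)) + ennreal (dtime t)"
      unfolding discounted_time_add[of \<alpha> "phi q" t]
      using phi_pos[OF q] t0 by (subst add.commute, intro ennreal_plus) (simp_all add: dtime_nonneg)
    finally have eq: "(\<integral>\<^sup>+x. alive_integral t (max 0 x) ?e \<partial>m) = ennreal (exp (- \<alpha> * t) * dtime (phi q))"
      by (simp add: ennreal_add_left_cancel add.commute)
    then show "(\<integral>\<^sup>+y. ?e y \<partial>R) < \<infinity>" by (simp add: int_R)
    show "(\<integral>\<^sup>+y. ?e y \<partial>R) = (\<integral>\<^sup>+y. ?e y \<partial>S)"
      using eq laplace_m[OF q] phi_pos[OF q] by (simp add: int_R int_S ennreal_mult dtime_nonneg)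
  qed
  then show ?thesis using int_R[OF h] int_S[OF h] by simp
qed

text \<open>The right-hand side is minus the derivative of the transform of \<open>m\<close> at \<open>v\<close>; a difference quotient
  bounds it from below.\<close>

lemma first_moment_lower:
  assumes v: "0 < v"
  shows "ennreal (exp (- \<alpha> * phi v) / mech v) \<le> (\<integral>\<^sup>+y. ennreal (y * exp (- v * y)) \<partial>m)"
proof (cases "(\<integral>\<^sup>+y. ennreal (y * exp (- v * y)) \<partial>m)")
  case (real r)
  have le: "(dtime (phi v) - dtime (phi (v + e))) / e \<le> r" if e: "0 < e" for e
  proof -
    have "(\<integral>\<^sup>+y. ennreal (exp (- v * y)) \<partial>m) \<le>
        (\<integral>\<^sup>+y. ennreal e * ennreal (y * exp (- v * y)) + ennreal (exp (- (v + e) * y)) \<partial>m)"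
    proof (rule nn_integral_mono_AE)
      show "AE y in m. ennreal (exp (- v * y)) \<le>
          ennreal e * ennreal (y * exp (- v * y)) + ennreal (exp (- (v + e) * y))"
        using AE_m_pos
      proof eventually_elim
        case (elim y)
        have "exp (- v * y) * (1 - e * y) \<le> exp (- v * y) * exp (- e * y)"
          using exp_ge_add_one_self[of "- e * y"] by (intro mult_left_mono) auto
        also have "\<dots> = exp (- (v + e) * y)" by (simp add: exp_add[symmetric] algebra_simps)
        finally have "exp (- v * y) \<le> e * (y * exp (- v * y)) + exp (- (v + e) * y)"
          by (simp add: algebra_simps)
        then show ?case using elim e
          by (simp add: ennreal_mult[symmetric] ennreal_plus[symmetric] ennreal_leI del: ennreal_plus)
      qed
    qed
    also have "\<dots> = (\<integral>\<^sup>+y. ennreal e * ennreal (y * exp (- v * y)) \<partial>m) + (\<integral>\<^sup>+y. ennreal (exp (- (v + e) * y)) \<partial>m)"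
      by (rule nn_integral_add) measurable
    also have "(\<integral>\<^sup>+y. ennreal e * ennreal (y * exp (- v * y)) \<partial>m) = ennreal (e * r)"
      using e real by (subst nn_integral_cmult) (simp_all add: ennreal_mult)
    also have "(\<integral>\<^sup>+y. ennreal (exp (- (v + e) * y)) \<partial>m) = ennreal (dtime (phi (v + e)))"
      using v e by (intro laplace_m) simp
    also have "(\<integral>\<^sup>+y. ennreal (exp (- v * y)) \<partial>m) = ennreal (dtime (phi v))"
      by (rule laplace_m[OF v])
    also have "ennreal (e * r) + ennreal (dtime (phi (v + e))) = ennreal (e * r + dtime (phi (v + e)))"
      using v e real phi_pos[of "v + e"] by (intro ennreal_plus[symmetric]) (auto simp: dtime_nonneg)
    finally have "ennreal (dtime (phi v)) \<le> ennreal (e * r + dtime (phi (v + e)))" .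
    then have "dtime (phi v) \<le> e * r + dtime (phi (v + e))"
      using v e real phi_pos[of "v + e"] by (subst (asm) ennreal_le_iff) (auto simp: dtime_nonneg)
    then show ?thesis using e by (simp add: field_simps)
  qed
  have "((\<lambda>q. dtime (phi q)) has_real_derivative exp (- \<alpha> * phi v) * - (1 / mech v)) (at v)"
    by (rule DERIV_chain2[OF discounted_time_DERIV phi_DERIV[OF v]])
  then have "((\<lambda>e. (dtime (phi (v + e)) - dtime (phi v)) / e) \<longlongrightarrow> exp (- \<alpha> * phi v) * - (1 / mech v)) (at 0)"
    by (simp add: DERIV_def)
  then have "((\<lambda>e. (dtime (phi (v + e)) - dtime (phi v)) / e) \<longlongrightarrow> exp (- \<alpha> * phi v) * - (1 / mech v)) (at_right 0)"
    by (rule filterlim_mono) (auto simp: at_le)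
  then have "- r \<le> exp (- \<alpha> * phi v) * - (1 / mech v)"
  proof (rule tendsto_lowerbound)
    show "eventually (\<lambda>e. - r \<le> (dtime (phi (v + e)) - dtime (phi v)) / e) (at_right 0)"
      using eventually_at_right_less[of 0]
    proof eventually_elim
      case (elim e)
      with le[of e] show ?case by (simp add: field_simps)
    qed
  qed simp
  then show ?thesis using real by (simp add: ennreal_leI)
qed simp

text \<open>By \<open>alive_integral_linear_lower\<close> the integral from the initial value \<open>y\<close> is at least
  \<open>(y / x - 1) * exp (- v * y)\<close> times the one from \<open>x\<close>. Integrating over \<open>y\<close> against \<open>m\<close> turns the larger
  side into the integral against \<open>m\<close>, by quasi-invariance, while the factor integrates to at least
  the difference of the first moment divided by \<open>x\<close> and the transform of \<open>m\<close> at \<open>v\<close>.\<close>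

lemma alive_integral_le_limit:
  assumes x: "0 < x" and t: "0 < t" and h: "h \<in> borel_measurable borel"
  shows "ennreal (exp (- \<alpha> * t) / (x * mech (phi_inv t)) - dtime t) * alive_integral t x h \<le>
    ennreal (exp (- \<alpha> * t)) * (\<integral>\<^sup>+y. h y \<partial>m)"
proof -
  define v where "v = phi_inv t"
  have v: "0 < v" "phi v = t" using t by (simp_all add: v_def phi_inv_pos phi_phi_inv)
  define A where "A = (\<integral>\<^sup>+y. ennreal ((y / x - 1) * exp (- v * y)) \<partial>m)"
  have "ennreal (1 / x) * (\<integral>\<^sup>+y. ennreal (y * exp (- v * y)) \<partial>m) =
      (\<integral>\<^sup>+y. ennreal (1 / x) * ennreal (y * exp (- v * y)) \<partial>m)"
    by (rule nn_integral_cmult[symmetric]) measurable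
  also have "\<dots> \<le> (\<integral>\<^sup>+y. ennreal ((y / x - 1) * exp (- v * y)) + ennreal (exp (- v * y)) \<partial>m)"
  proof (rule nn_integral_mono)
    fix y
    have "ennreal (1 / x) * ennreal (y * exp (- v * y)) = ennreal (1 / x * (y * exp (- v * y)))"
      using x by (intro ennreal_mult'[symmetric]) simp
    also have "\<dots> = ennreal ((y / x - 1) * exp (- v * y) + exp (- v * y))"
      using x by (simp add: field_simps)
    also have "\<dots> \<le> ennreal (max 0 ((y / x - 1) * exp (- v * y)) + exp (- v * y))"
      by (intro ennreal_leI) simp
    also have "\<dots> = ennreal ((y / x - 1) * exp (- v * y)) + ennreal (exp (- v * y))"
      by (subst ennreal_plus) (simp_all add: max_def ennreal_neg)
    finally show "ennreal (1 / x) * ennreal (y * exp (- v * y)) \<le>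
        ennreal ((y / x - 1) * exp (- v * y)) + ennreal (exp (- v * y))" .
  qed
  also have "\<dots> = A + ennreal (dtime t)"
    unfolding A_def using laplace_m[OF v(1)] v(2) by (subst nn_integral_add) simp_all
  finally have "ennreal (1 / x) * ennreal (exp (- \<alpha> * t) / mech v) \<le> A + ennreal (dtime t)"
    using first_moment_lower[OF v(1)] unfolding v(2)
    by (elim order_trans[rotated]) (intro mult_left_mono, auto)
  then have "ennreal (exp (- \<alpha> * t) / (x * mech v)) \<le> A + ennreal (dtime t)"
    using x mech_pos[OF v(1)] by (simp add: ennreal_mult[symmetric])
  then have A: "ennreal (exp (- \<alpha> * t) / (x * mech v) - dtime t) \<le> A"
    using t by (subst ennreal_minus[symmetric]) (auto simp: dtime_nonneg ennreal_minus_le_iff add.commute)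
  have "ennreal (exp (- \<alpha> * t) / (x * mech v) - dtime t) * alive_integral t x h \<le> A * alive_integral t x h"
    using A by (rule mult_right_mono) simp
  also have "\<dots> = (\<integral>\<^sup>+y. ennreal ((y / x - 1) * exp (- v * y)) * alive_integral t x h \<partial>m)"
    unfolding A_def by (rule nn_integral_multc[symmetric]) measurable
  also have "\<dots> \<le> (\<integral>\<^sup>+y. alive_integral t (max 0 y) h \<partial>m)"
  proof (rule nn_integral_mono_AE)
    show "AE y in m. ennreal ((y / x - 1) * exp (- v * y)) * alive_integral t x h \<le> alive_integral t (max 0 y) h"
      using AE_m_pos
    proof eventually_elim
      case (elim y)
      then show ?case
        using alive_integral_linear_lower[OF x _ t h, of y] by (simp add: v_def mult.commute)
    qed
  qed
  also have "\<dots> = ennreal (exp (- \<alpha> * t)) * (\<integral>\<^sup>+y. h y \<partial>m)"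
    by (rule quasi_invariant[OF t h])
  finally show ?thesis by (simp add: v_def)
qed

end

section \<open>Rescaled laws\<close>

text \<open>If the sum of two quantities is asymptotically at least the sum of their upper bounds, then
  neither can stay below its own bound.\<close>

lemma tendsto_of_complementary_bounds:
  fixes p q :: "'a \<Rightarrow> ennreal" and l :: "'a \<Rightarrow> real"
  assumes l: "eventually (\<lambda>t. ennreal (l t) \<le> p t + q t) F" "(l \<longlongrightarrow> a + b) F"
    and p: "eventually (\<lambda>t. p t \<le> p' t) F" "(p' \<longlongrightarrow> ennreal a) F"
    and q: "eventually (\<lambda>t. q t \<le> q' t) F" "(q' \<longlongrightarrow> ennreal b) F"
    and nonneg: "0 \<le> a" "0 \<le> b"
  shows "(p \<longlongrightarrow> ennreal a) F"
proof (rule order_tendstoI)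
  fix c assume "ennreal a < c"
  with p(2) have "eventually (\<lambda>t. p' t < c) F" by (rule order_tendstoD)
  with p(1) show "eventually (\<lambda>t. p t < c) F" by eventually_elim (rule le_less_trans)
next
  fix c assume c: "c < ennreal a"
  then obtain r where r: "c = ennreal r" "0 \<le> r" "r < a"
    by (cases c) (auto simp: ennreal_less_iff)
  define d where "d = (a - r) / 2"
  have d: "0 < d" "r + d = a - d" using r by (simp_all add: d_def field_simps)
  have "eventually (\<lambda>t. q' t < ennreal (b + d)) F"
    using q(2) by (rule order_tendstoD) (use d nonneg in \<open>simp add: ennreal_less_iff del: ennreal_plus\<close>)
  moreover have "eventually (\<lambda>t. a + b - d < l t) F"
    using l(2) by (rule order_tendstoD) (use d in simp)
  ultimately show "eventually (\<lambda>t. c < p t) F"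
    using l(1) q(1)
  proof eventually_elim
    case (elim t)
    show ?case
    proof (rule ccontr)
      assume "\<not> c < p t"
      then have "ennreal (l t) \<le> c + ennreal (b + d)"
        using elim by (intro order_trans[OF elim(3)] add_mono) auto
      also have "\<dots> = ennreal (r + (b + d))"
        using r d nonneg by (simp add: ennreal_plus[symmetric] del: ennreal_plus)
      finally have "l t \<le> r + (b + d)"
        using r d nonneg by (subst (asm) ennreal_le_iff) auto
      with elim(2) d show False by simp
    qed
  qed
qed

text \<open>Every nonnegative function is approximated from below by functions dominated by multiples of a
  fixed positive function \<open>w\<close>.\<close>

lemma nn_integral_truncation_LIMSEQ:
  fixes h w :: "'a \<Rightarrow> ennreal"
  assumes [measurable]: "h \<in> borel_measurable N" "w \<in> borel_measurable N"
    and w: "\<And>y. 0 < w y"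
  shows "(\<lambda>k. \<integral>\<^sup>+y. min (h y) (of_nat k * w y) \<partial>N) \<longlonglongrightarrow> (\<integral>\<^sup>+y. h y \<partial>N)"
proof (rule nn_integral_LIMSEQ)
  show "incseq (\<lambda>k y. min (h y) (of_nat k * w y))"
    by (intro monoI le_funI min.mono mult_right_mono) auto
  show "(\<lambda>y. min (h y) (of_nat k * w y)) \<in> borel_measurable N" for k by measurable
  fix y
  have "w y \<noteq> 0" using w[of y] by simp
  then have "(\<lambda>k. of_nat k * w y) \<longlonglongrightarrow> \<top> * w y"
    by (intro tendsto_mult_ennreal of_nat_tendsto_top_ennreal tendsto_const) auto
  also have "\<top> * w y = \<top>" using \<open>w y \<noteq> 0\<close> by (simp add: ennreal_top_mult)
  finally have "(\<lambda>k. min (h y) (of_nat k * w y)) \<longlonglongrightarrow> min (h y) \<top>"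
    by (intro tendsto_min tendsto_const)
  then show "(\<lambda>k. min (h y) (of_nat k * w y)) \<longlonglongrightarrow> h y" by simp
qed

context cb_process
begin

definition rescaled_integral :: "real \<Rightarrow> real \<Rightarrow> (real \<Rightarrow> ennreal) \<Rightarrow> ennreal" where
  "rescaled_integral t x h = ennreal (1 / (x * mech (phi_inv t))) * alive_integral t x h"

lemma rescaled_integral_mono:
  "(\<And>y. 0 < y \<Longrightarrow> g y \<le> h y) \<Longrightarrow> rescaled_integral t x g \<le> rescaled_integral t x h"
  unfolding rescaled_integral_def by (intro mult_left_mono alive_integral_mono) auto

lemma rescaled_integral_add:
  assumes "g \<in> borel_measurable borel" "h \<in> borel_measurable borel"
  shows "rescaled_integral t x (\<lambda>y. g y + h y) = rescaled_integral t x g + rescaled_integral t x h"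
  by (simp add: rescaled_integral_def alive_integral_add[OF assms] distrib_left)

lemma rescaled_integral_cmult:
  assumes [measurable]: "h \<in> borel_measurable borel"
  shows "rescaled_integral t x (\<lambda>y. c * h y) = c * rescaled_integral t x h"
proof -
  have "alive_integral t x (\<lambda>y. c * h y) = c * alive_integral t x h"
    unfolding alive_integral_def mult.assoc by (rule nn_integral_cmult) measurable
  then show ?thesis by (simp add: rescaled_integral_def mult.left_commute)
qed

text \<open>With \<open>v = phi_inv t\<close> and \<open>w = u t q\<close> the increment \<open>phi w - phi v\<close> equals \<open>phi q\<close>. Comparing the mechanism
  with a quadratic function bounds this increment by \<open>v / w * ((v - w) / mech v)\<close>, and comparing it with
  a linear one bounds \<open>w / v\<close> from below. When \<open>\<alpha> = 0\<close> the resulting bound tends to \<open>phi q\<close>.\<close>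

lemma phi_inv_minus_u_lower:
  assumes "0 < t" "0 < q"
  shows "phi q * exp (- (mech (phi_inv t) / phi_inv t) * phi q) \<le> (phi_inv t - u t q) / mech (phi_inv t)"
proof -
  define v where "v = phi_inv t"
  define w where "w = u t q"
  have v: "0 < v" "phi v = t" using assms by (simp_all add: v_def phi_inv_pos phi_phi_inv)
  have w: "0 < w" "phi w = t + phi q" using assms by (simp_all add: w_def u_pos phi_u)
  have q: "0 < phi q" using assms by (simp add: phi_pos)
  have "w \<le> v" using phi_less_iff[of w v] phi_less_iff[of v w] v w q by simp
  have m: "0 < mech v" using v by (simp add: mech_pos)
  have "ln (v / w) \<le> mech v / v * phi q"
    using phi_diff_ge_ln[OF w(1) \<open>w \<le> v\<close>] v w m by (simp add: field_simps)
  then have "exp (- (mech v / v) * phi q) \<le> exp (- ln (v / w))" by simp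
  also have "\<dots> = w / v" using v w by (simp add: exp_minus)
  finally have "phi q * exp (- (mech v / v) * phi q) \<le> phi q * (w / v)"
    using q by (intro mult_left_mono) auto
  also have "\<dots> \<le> (v / w * ((v - w) / mech v)) * (w / v)"
    using phi_diff_le_quadratic[OF w(1) \<open>w \<le> v\<close>] v w by (intro mult_right_mono) auto
  also have "\<dots> = (v - w) / mech v" using v w by simp
  finally show ?thesis by (simp add: v_def w_def)
qed

lemma rescaled_integral_exp_lower:
  assumes x: "0 < x" and t: "0 < t" and q: "0 < q"
  shows "ennreal (exp (- x * phi_inv t) * (phi q * exp (- (mech (phi_inv t) / phi_inv t) * phi q))) \<le>
    rescaled_integral t x (\<lambda>y. ennreal (exp (- q * y)))"
proof -
  define v where "v = phi_inv t"
  define w where "w = u t q"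
  have v: "0 < v" "0 < mech v" using t by (simp_all add: v_def phi_inv_pos mech_pos)
  let ?A = "alive_integral t x (\<lambda>y. ennreal (exp (- q * y)))"
  have A: "?A + ennreal (exp (- x * v)) = ennreal (exp (- x * w))"
    using alive_integral_exp[of x t q] x t q by (simp add: v_def w_def)
  have "?A = ennreal (exp (- x * w)) - ennreal (exp (- x * v))"
    unfolding A[symmetric] by (rule ennreal_add_diff_cancel_right[symmetric]) simp
  then have A': "?A = ennreal (exp (- x * w) - exp (- x * v))" by (simp add: ennreal_minus)
  have "x * (v - w) \<le> exp (x * (v - w)) - 1"
    using exp_ge_add_one_self[of "x * (v - w)"] by linarith
  then have "exp (- x * v) * (x * (v - w)) \<le> exp (- x * v) * (exp (x * (v - w)) - 1)"
    by (rule mult_left_mono) simp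
  also have "\<dots> = exp (- x * w) - exp (- x * v)"
    by (simp add: right_diff_distrib exp_add[symmetric])
  finally have "1 / (x * mech v) * (exp (- x * v) * (x * (v - w))) \<le>
      1 / (x * mech v) * (exp (- x * w) - exp (- x * v))"
    using x v by (intro mult_left_mono) auto
  moreover have "exp (- x * v) * (phi q * exp (- (mech v / v) * phi q)) \<le> exp (- x * v) * ((v - w) / mech v)"
    unfolding v_def w_def using t q by (intro mult_left_mono phi_inv_minus_u_lower) auto
  moreover have "exp (- x * v) * ((v - w) / mech v) = 1 / (x * mech v) * (exp (- x * v) * (x * (v - w)))"
    using x v by simp
  ultimately have "exp (- x * v) * (phi q * exp (- (mech v / v) * phi q)) \<le>
      1 / (x * mech v) * (exp (- x * w) - exp (- x * v))" by simp
  then have "ennreal (exp (- x * v) * (phi q * exp (- (mech v / v) * phi q))) \<le>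
      ennreal (1 / (x * mech v) * (exp (- x * w) - exp (- x * v)))"
    by (rule ennreal_leI)
  also have "\<dots> = ennreal (1 / (x * mech v)) * ?A"
    unfolding A' using x v by (intro ennreal_mult') auto
  finally show ?thesis by (simp add: rescaled_integral_def v_def)
qed

end

context cb_limit_measure
begin

section \<open>Convergence in the critical case\<close>

lemma rescaled_integral_le_critical:
  assumes "\<alpha> = 0" and x: "0 < x" and t: "0 < t" and h: "h \<in> borel_measurable borel"
    and small: "x * (t * mech (phi_inv t)) < 1"
  shows "rescaled_integral t x h \<le> ennreal (1 / (1 - x * (t * mech (phi_inv t)))) * (\<integral>\<^sup>+y. h y \<partial>m)"
proof -
  define c where "c = x * mech (phi_inv t)"
  define d where "d = 1 - x * (t * mech (phi_inv t))"
  have c: "0 < c" and d: "0 < d" "1 / c - t = d * (1 / c)"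
    using x t small mech_pos[OF phi_inv_pos[OF t]] by (simp_all add: c_def d_def field_simps)
  have "rescaled_integral t x h = ennreal (1 / d * (1 / c - t)) * alive_integral t x h"
    using c d by (simp add: rescaled_integral_def c_def)
  also have "\<dots> = ennreal (1 / d) * (ennreal (1 / c - t) * alive_integral t x h)"
    using d c by (subst ennreal_mult) (auto simp: mult.assoc)
  also have "\<dots> \<le> ennreal (1 / d) * (\<integral>\<^sup>+y. h y \<partial>m)"
    using alive_integral_le_limit[OF x t h] \<open>\<alpha> = 0\<close>
    by (intro mult_left_mono) (simp_all add: c_def discounted_time_def)
  finally show ?thesis by (simp add: d_def)
qed

lemma rescaled_integral_bound_critical:
  assumes "\<alpha> = 0" and x: "0 < x"
  defines "b \<equiv> \<lambda>t. ennreal (1 / (1 - x * (t * mech (phi_inv t))))"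
  shows "eventually (\<lambda>t. \<forall>h\<in>borel_measurable borel. rescaled_integral t x h \<le> b t * (\<integral>\<^sup>+y. h y \<partial>m)) at_top"
    and "((\<lambda>t. b t * c) \<longlongrightarrow> c) at_top"
proof -
  have lim: "((\<lambda>t. x * (t * mech (phi_inv t))) \<longlongrightarrow> x * 0) at_top"
    by (intro tendsto_mult tendsto_const time_mech_phi_inv)
  then have "eventually (\<lambda>t. x * (t * mech (phi_inv t)) < 1) at_top"
    by (intro order_tendstoD(2)) auto
  then show "eventually (\<lambda>t. \<forall>h\<in>borel_measurable borel. rescaled_integral t x h \<le> b t * (\<integral>\<^sup>+y. h y \<partial>m)) at_top"
    using eventually_gt_at_top[of 0] unfolding b_def
    by eventually_elim (use rescaled_integral_le_critical[OF assms(1) x] in blast)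
  have "((\<lambda>t. 1 / (1 - x * (t * mech (phi_inv t)))) \<longlongrightarrow> 1 / (1 - x * 0)) at_top"
    using lim by (intro tendsto_divide tendsto_diff tendsto_const) auto
  then have "(b \<longlongrightarrow> ennreal 1) at_top" unfolding b_def by (intro tendsto_ennrealI) simp
  then have "((\<lambda>t. b t * c) \<longlongrightarrow> ennreal 1 * c) at_top"
    by (intro tendsto_mult_ennreal tendsto_const) auto
  then show "((\<lambda>t. b t * c) \<longlongrightarrow> c) at_top" by simp
qed

text \<open>The total \<open>k * exp (- y)\<close> of \<open>h\<close> and its complement has convergent integrals, and both summands obey
  the upper bound by the limit measure.\<close>

lemma rescaled_integral_tendsto_dominated:
  assumes "\<alpha> = 0" and x: "0 < x" and h [measurable]: "h \<in> borel_measurable borel"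
    and dom: "\<And>y. h y \<le> of_nat k * ennreal (exp (- 1 * y))"
  shows "((\<lambda>t. rescaled_integral t x h) \<longlongrightarrow> (\<integral>\<^sup>+y. h y \<partial>m)) at_top"
proof -
  let ?e = "\<lambda>y::real. ennreal (exp (- 1 * y))"
  define g where "g y = of_nat k * ?e y - h y" for y
  have g [measurable]: "g \<in> borel_measurable borel" unfolding g_def by measurable
  have hg: "h y + g y = of_nat k * ?e y" for y
    unfolding g_def using dom[of y] by (intro add_diff_inverse_ennreal) auto
  have "(\<integral>\<^sup>+y. h y \<partial>m) + (\<integral>\<^sup>+y. g y \<partial>m) = (\<integral>\<^sup>+y. of_nat k * ?e y \<partial>m)"
    by (subst nn_integral_add[symmetric]) (simp_all only: hg, measurable)
  also have "\<dots> = of_nat k * (\<integral>\<^sup>+y. ?e y \<partial>m)"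
    by (rule nn_integral_cmult) measurable
  also have "(\<integral>\<^sup>+y. ?e y \<partial>m) = ennreal (phi 1)"
    using laplace_m[of 1] \<open>\<alpha> = 0\<close> by (simp add: discounted_time_def)
  also have "of_nat k * ennreal (phi 1) = ennreal (real k * phi 1)"
    by (simp add: ennreal_mult' ennreal_of_nat_eq_real_of_nat)
  finally have sum: "(\<integral>\<^sup>+y. h y \<partial>m) + (\<integral>\<^sup>+y. g y \<partial>m) = ennreal (real k * phi 1)" .
  then have "(\<integral>\<^sup>+y. h y \<partial>m) \<noteq> \<top>" "(\<integral>\<^sup>+y. g y \<partial>m) \<noteq> \<top>"
    using ennreal_neq_top[of "real k * phi 1"] by (metis ennreal_add_eq_top)+
  then obtain a b where a: "(\<integral>\<^sup>+y. h y \<partial>m) = ennreal a" "0 \<le> a" and b: "(\<integral>\<^sup>+y. g y \<partial>m) = ennreal b" "0 \<le> b"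
    by (cases "\<integral>\<^sup>+y. h y \<partial>m"; cases "\<integral>\<^sup>+y. g y \<partial>m") auto
  have ab: "a + b = real k * phi 1"
    using sum a b phi_pos[of 1] by (simp add: ennreal_plus[symmetric] del: ennreal_plus)
  define l where "l t = real k * (exp (- x * phi_inv t) *
    (phi 1 * exp (- (mech (phi_inv t) / phi_inv t) * phi 1)))" for t
  have "(l \<longlongrightarrow> real k * (exp (- x * 0) * (phi 1 * exp (- \<alpha> * phi 1)))) at_top"
    unfolding l_def
    by (intro tendsto_mult tendsto_const tendsto_exp tendsto_minus phi_inv_tendsto_0 mech_phi_inv_slope)
  then have l: "(l \<longlongrightarrow> a + b) at_top" using \<open>\<alpha> = 0\<close> by (simp add: ab)
  have low: "eventually (\<lambda>t. ennreal (l t) \<le> rescaled_integral t x h + rescaled_integral t x g) at_top"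
    using eventually_gt_at_top[of 0]
  proof eventually_elim
    case (elim t)
    have "ennreal (l t) = of_nat k * ennreal (exp (- x * phi_inv t) *
        (phi 1 * exp (- (mech (phi_inv t) / phi_inv t) * phi 1)))"
      unfolding l_def by (simp add: ennreal_mult' ennreal_of_nat_eq_real_of_nat)
    also have "\<dots> \<le> of_nat k * rescaled_integral t x ?e"
      by (intro mult_left_mono rescaled_integral_exp_lower x elim) auto
    also have "\<dots> = rescaled_integral t x (\<lambda>y. of_nat k * ?e y)"
      by (rule rescaled_integral_cmult[symmetric]) measurable
    also have "\<dots> = rescaled_integral t x h + rescaled_integral t x g"
      by (simp only: hg[symmetric] rescaled_integral_add[OF h g])
    finally show ?case .
  qed
  note bound = rescaled_integral_bound_critical[OF assms(1) x]
  have "((\<lambda>t. rescaled_integral t x h) \<longlongrightarrow> ennreal a) at_top"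
  proof (rule tendsto_of_complementary_bounds[OF low l])
    show "eventually (\<lambda>t. rescaled_integral t x h \<le>
        ennreal (1 / (1 - x * (t * mech (phi_inv t)))) * ennreal a) at_top"
      using bound(1) by eventually_elim (drule bspec[OF _ h], simp add: a)
    show "eventually (\<lambda>t. rescaled_integral t x g \<le>
        ennreal (1 / (1 - x * (t * mech (phi_inv t)))) * ennreal b) at_top"
      using bound(1) by eventually_elim (drule bspec[OF _ g], simp add: b)
  qed (fact bound(2) a b)+
  then show ?thesis by (simp add: a)
qed

text \<open>The upper bound is immediate from the comparison with \<open>m\<close>; the lower bound follows by truncation
  at multiples of \<open>exp (- y)\<close> and covers the case of an infinite integral.\<close>

theorem rescaled_integral_tendsto_critical:
  assumes "\<alpha> = 0" and x: "0 < x" and h [measurable]: "h \<in> borel_measurable borel"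
  shows "((\<lambda>t. rescaled_integral t x h) \<longlongrightarrow> (\<integral>\<^sup>+y. h y \<partial>m)) at_top"
proof (rule order_tendstoI)
  fix c assume c: "(\<integral>\<^sup>+y. h y \<partial>m) < c"
  note bound = rescaled_integral_bound_critical[OF assms(1) x]
  have "eventually (\<lambda>t. ennreal (1 / (1 - x * (t * mech (phi_inv t)))) * (\<integral>\<^sup>+y. h y \<partial>m) < c) at_top"
    using bound(2) c by (rule order_tendstoD)
  with bound(1) show "eventually (\<lambda>t. rescaled_integral t x h < c) at_top"
    by eventually_elim (drule bspec[OF _ h], erule le_less_trans)
next
  fix c assume c: "c < (\<integral>\<^sup>+y. h y \<partial>m)"
  define h' where "h' k y = min (h y) (of_nat k * ennreal (exp (- 1 * y)))" for k :: nat and y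
  have [measurable]: "h' k \<in> borel_measurable borel" for k unfolding h'_def by measurable
  have "(\<lambda>k. \<integral>\<^sup>+y. h' k y \<partial>m) \<longlonglongrightarrow> (\<integral>\<^sup>+y. h y \<partial>m)"
    unfolding h'_def by (rule nn_integral_truncation_LIMSEQ) auto
  then have "eventually (\<lambda>k. c < (\<integral>\<^sup>+y. h' k y \<partial>m)) sequentially"
    using c by (rule order_tendstoD)
  then obtain k where k: "c < (\<integral>\<^sup>+y. h' k y \<partial>m)"
    by (auto simp: eventually_sequentially)
  have "((\<lambda>t. rescaled_integral t x (h' k)) \<longlongrightarrow> (\<integral>\<^sup>+y. h' k y \<partial>m)) at_top"
    by (rule rescaled_integral_tendsto_dominated[OF assms(1) x, where k=k]) (auto simp: h'_def)
  then have "eventually (\<lambda>t. c < rescaled_integral t x (h' k)) at_top"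
    using k by (rule order_tendstoD)
  then show "eventually (\<lambda>t. c < rescaled_integral t x h) at_top"
  proof eventually_elim
    case (elim t)
    also have "rescaled_integral t x (h' k) \<le> rescaled_integral t x h"
      by (rule rescaled_integral_mono) (simp add: h'_def)
    finally show ?case .
  qed
qed

section \<open>Convergence in the subcritical case\<close>

text \<open>The initial value is divided into \<open>n\<close> equal pieces, and the comparison with \<open>m\<close> is applied to one
  piece. The resulting error is of order \<open>1 / n\<close> for fixed \<open>t\<close>, whereas the defect of the subdivision
  stays bounded by \<open>(x * phi_inv t)\<^sup>2\<close>; then \<open>n\<close> tends to infinity.\<close>

lemma rescaled_integral_le_subcritical:
  assumes x: "0 < x" and t: "0 < t" and h: "h \<in> borel_measurable borel" and h1: "\<And>y. h y \<le> 1"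
  shows "rescaled_integral t x h \<le> (\<integral>\<^sup>+y. h y \<partial>m) + ennreal (x * ((phi_inv t)\<^sup>2 / mech (phi_inv t)))"
proof (cases "\<integral>\<^sup>+y. h y \<partial>m")
  case (real i)
  define v where "v = phi_inv t"
  have v: "0 < v" "0 < mech v" using t by (simp_all add: v_def phi_inv_pos mech_pos)
  have A_le: "alive_integral t z h \<le> ennreal (z * v)" if "0 \<le> z" for z
  proof -
    have "alive_integral t z h \<le> alive_integral t z (\<lambda>_. 1)"
      using h1 by (intro alive_integral_mono) auto
    also have "\<dots> = ennreal (1 - exp (- z * v))"
      unfolding v_def by (rule alive_integral_one[OF that t])
    also have "\<dots> \<le> ennreal (z * v)"
      using exp_ge_add_one_self[of "- z * v"] by (intro ennreal_leI) simp
    finally show ?thesis .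
  qed
  define A where "A z = enn2real (alive_integral t z h)" for z
  have A: "alive_integral t z h = ennreal (A z)" if "0 \<le> z" for z
    using A_le[OF that] unfolding A_def by (intro ennreal_enn2real[symmetric]) (auto simp: less_top[symmetric] top_unique)
  have A0: "0 \<le> A z" for z by (simp add: A_def)
  have A_le': "A z \<le> z * v" if "0 \<le> z" for z
    using A_le[OF that] A[OF that] A0[of z] that v by (simp add: ennreal_le_iff)
  have est: "A x / (x * mech v) \<le> i + x * (v\<^sup>2 / mech v) + dtime t * exp (\<alpha> * t) * x * v / real n"
    if n: "0 < n" for n :: nat
  proof -
    define z where "z = x / real n"
    have z: "0 < z" "real n * z = x" using x n by (simp_all add: z_def)
    have "ennreal (A x) \<le> of_nat n * ennreal (A z) + ennreal ((x * v)\<^sup>2)"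
      using alive_integral_subdivide[of z t h n] z t h h1 x by (simp add: A v_def)
    also have "\<dots> = ennreal (real n * A z + (x * v)\<^sup>2)"
      using A0[of z] by (simp add: ennreal_mult' ennreal_of_nat_eq_real_of_nat)
    finally have 1: "A x \<le> real n * A z + (x * v)\<^sup>2"
      using A0[of z] by (subst (asm) ennreal_le_iff) auto
    have "ennreal (exp (- \<alpha> * t) / (z * mech v) - dtime t) * ennreal (A z) \<le> ennreal (exp (- \<alpha> * t)) * ennreal i"
      using alive_integral_le_limit[OF z(1) t h] real z by (simp add: A v_def)
    then have "ennreal ((exp (- \<alpha> * t) / (z * mech v) - dtime t) * A z) \<le> ennreal (exp (- \<alpha> * t) * i)"
      using A0[of z] real by (simp add: ennreal_mult'' ennreal_mult')
    then have "(exp (- \<alpha> * t) / (z * mech v) - dtime t) * A z \<le> exp (- \<alpha> * t) * i"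
      using real by (subst (asm) ennreal_le_iff) auto
    then have "exp (- \<alpha> * t) * (A z / (z * mech v)) \<le> exp (- \<alpha> * t) * i + dtime t * A z"
      by (simp add: left_diff_distrib)
    also have "\<dots> \<le> exp (- \<alpha> * t) * i + dtime t * (z * v)"
      using A_le'[of z] z t by (intro add_left_mono mult_left_mono) (auto simp: dtime_nonneg)
    finally have "exp (\<alpha> * t) * (exp (- \<alpha> * t) * (A z / (z * mech v))) \<le>
        exp (\<alpha> * t) * (exp (- \<alpha> * t) * i + dtime t * (z * v))"
      by (intro mult_left_mono) auto
    then have 2: "A z / (z * mech v) \<le> i + dtime t * exp (\<alpha> * t) * (z * v)"
      by (simp add: distrib_left mult.assoc[symmetric] exp_add[symmetric]) (simp add: ac_simps)
    have "A x / (x * mech v) \<le> (real n * A z + (x * v)\<^sup>2) / (x * mech v)"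
      using 1 x v by (intro divide_right_mono) auto
    also have "\<dots> = A z / (z * mech v) + x * (v\<^sup>2 / mech v)"
      using x n v unfolding z_def by (simp add: field_simps power2_eq_square)
    also have "\<dots> \<le> i + dtime t * exp (\<alpha> * t) * (z * v) + x * (v\<^sup>2 / mech v)"
      using 2 by simp
    finally show ?thesis by (simp add: z_def algebra_simps)
  qed
  have "A x / (x * mech v) \<le> i + x * (v\<^sup>2 / mech v)"
  proof (rule LIMSEQ_le_const)
    have "(\<lambda>n. (i + x * (v\<^sup>2 / mech v)) + dtime t * exp (\<alpha> * t) * x * v / real n) \<longlonglongrightarrow>
        (i + x * (v\<^sup>2 / mech v)) + 0"
      by (intro tendsto_add tendsto_const lim_const_over_n)
    then show "(\<lambda>n. (i + x * (v\<^sup>2 / mech v)) + dtime t * exp (\<alpha> * t) * x * v / real n) \<longlonglongrightarrow>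
        i + x * (v\<^sup>2 / mech v)" by simp
    show "\<exists>N. \<forall>n\<ge>N. A x / (x * mech v) \<le> i + x * (v\<^sup>2 / mech v) + dtime t * exp (\<alpha> * t) * x * v / real n"
      using est by (intro exI[of _ 1]) auto
  qed
  then have "ennreal (1 / (x * mech v) * A x) \<le> ennreal (i + x * (v\<^sup>2 / mech v))"
    by (intro ennreal_leI) simp
  also have "ennreal (1 / (x * mech v) * A x) = rescaled_integral t x h"
    using x v unfolding rescaled_integral_def v_def[symmetric] A[OF less_imp_le[OF x]]
    by (intro ennreal_mult') auto
  also have "ennreal (i + x * (v\<^sup>2 / mech v)) = (\<integral>\<^sup>+y. h y \<partial>m) + ennreal (x * (v\<^sup>2 / mech v))"
    using x v real by simp
  finally show ?thesis by (simp add: v_def)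
qed simp

text \<open>Both \<open>h\<close> and \<open>1 - h\<close> satisfy the upper bound, and the total rescaled mass converges to the mass
  \<open>1 / \<alpha>\<close> of \<open>m\<close> because \<open>mech v / v\<close> tends to \<open>\<alpha>\<close>.\<close>

theorem rescaled_integral_tendsto_subcritical:
  assumes \<alpha>: "0 < \<alpha>" and mass: "emeasure m UNIV = ennreal (1 / \<alpha>)"
    and x: "0 < x" and h [measurable]: "h \<in> borel_measurable borel" and h1: "\<And>y. h y \<le> 1"
  shows "((\<lambda>t. rescaled_integral t x h) \<longlongrightarrow> (\<integral>\<^sup>+y. h y \<partial>m)) at_top"
proof -
  define g where "g y = 1 - h y" for y
  have g [measurable]: "g \<in> borel_measurable borel" unfolding g_def by measurable
  have g1: "g y \<le> 1" for y by (simp add: g_def diff_le_self_ennreal)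
  have hg: "h y + g y = 1" for y
    unfolding g_def using h1[of y] by (intro add_diff_inverse_ennreal) auto
  have "(\<integral>\<^sup>+y. h y \<partial>m) + (\<integral>\<^sup>+y. g y \<partial>m) = (\<integral>\<^sup>+y. 1 \<partial>m)"
    by (subst nn_integral_add[symmetric]) (simp_all only: hg, measurable)
  also have "\<dots> = ennreal (1 / \<alpha>)"
    using mass sets_eq_imp_space_eq[OF sets_m] by simp
  finally have sum: "(\<integral>\<^sup>+y. h y \<partial>m) + (\<integral>\<^sup>+y. g y \<partial>m) = ennreal (1 / \<alpha>)" .
  then have "(\<integral>\<^sup>+y. h y \<partial>m) \<noteq> \<top>" "(\<integral>\<^sup>+y. g y \<partial>m) \<noteq> \<top>"
    using ennreal_neq_top[of "1 / \<alpha>"] by (metis ennreal_add_eq_top)+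
  then obtain a b where a: "(\<integral>\<^sup>+y. h y \<partial>m) = ennreal a" "0 \<le> a" and b: "(\<integral>\<^sup>+y. g y \<partial>m) = ennreal b" "0 \<le> b"
    by (cases "\<integral>\<^sup>+y. h y \<partial>m"; cases "\<integral>\<^sup>+y. g y \<partial>m") auto
  have ab: "a + b = 1 / \<alpha>"
    using sum a b \<alpha> by (simp add: ennreal_plus[symmetric] del: ennreal_plus)
  define l where "l t = exp (- x * phi_inv t) * (1 / (mech (phi_inv t) / phi_inv t))" for t
  have "(l \<longlongrightarrow> exp (- x * 0) * (1 / \<alpha>)) at_top"
    unfolding l_def using \<alpha>
    by (intro tendsto_mult tendsto_divide tendsto_const tendsto_exp phi_inv_tendsto_0 mech_phi_inv_slope) simp
  then have l: "(l \<longlongrightarrow> a + b) at_top" by (simp add: ab)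
  have low: "eventually (\<lambda>t. ennreal (l t) \<le> rescaled_integral t x h + rescaled_integral t x g) at_top"
    using eventually_gt_at_top[of 0]
  proof eventually_elim
    case (elim t)
    define v where "v = phi_inv t"
    have v: "0 < v" "0 < mech v" using elim by (simp_all add: v_def phi_inv_pos mech_pos)
    have "exp (- x * v) * (1 + x * v) \<le> exp (- x * v) * exp (x * v)"
      by (intro mult_left_mono exp_ge_add_one_self) simp
    then have "exp (- x * v) * (x * v) \<le> 1 - exp (- x * v)"
      by (simp add: exp_add[symmetric] distrib_left)
    then have "1 / (x * mech v) * (exp (- x * v) * (x * v)) \<le> 1 / (x * mech v) * (1 - exp (- x * v))"
      using x v by (intro mult_left_mono) auto
    then have "l t \<le> 1 / (x * mech v) * (1 - exp (- x * v))"
      using x v by (simp add: l_def v_def[symmetric])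
    then have "ennreal (l t) \<le> ennreal (1 / (x * mech v) * (1 - exp (- x * v)))"
      by (rule ennreal_leI)
    also have "\<dots> = ennreal (1 / (x * mech v)) * ennreal (1 - exp (- x * v))"
      using x v by (intro ennreal_mult') auto
    also have "\<dots> = rescaled_integral t x (\<lambda>_. 1)"
      using alive_integral_one[of x t] x elim by (simp add: rescaled_integral_def v_def)
    also have "\<dots> = rescaled_integral t x (\<lambda>y. h y + g y)"
      by (simp only: hg)
    also have "\<dots> = rescaled_integral t x h + rescaled_integral t x g"
      by (rule rescaled_integral_add[OF h g])
    finally show ?case .
  qed
  have err: "((\<lambda>t. c + ennreal (x * ((phi_inv t)\<^sup>2 / mech (phi_inv t)))) \<longlongrightarrow> c) at_top" for c
  proof -
    have "((\<lambda>t. phi_inv t * (1 / (mech (phi_inv t) / phi_inv t))) \<longlongrightarrow> 0 * (1 / \<alpha>)) at_top"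
      using \<alpha> by (intro tendsto_mult tendsto_divide tendsto_const phi_inv_tendsto_0 mech_phi_inv_slope) simp
    then have "((\<lambda>t. ennreal (x * (phi_inv t * (1 / (mech (phi_inv t) / phi_inv t))))) \<longlongrightarrow> ennreal (x * 0)) at_top"
      by (intro tendsto_ennrealI tendsto_mult tendsto_const) simp
    then have "((\<lambda>t. c + ennreal (x * (phi_inv t * (1 / (mech (phi_inv t) / phi_inv t))))) \<longlongrightarrow> c + ennreal (x * 0)) at_top"
      by (intro tendsto_add tendsto_const)
    then show ?thesis by (simp add: power2_eq_square)
  qed
  have "((\<lambda>t. rescaled_integral t x h) \<longlongrightarrow> ennreal a) at_top"
  proof (rule tendsto_of_complementary_bounds[OF low l])
    show "eventually (\<lambda>t. rescaled_integral t x h \<le>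
        ennreal a + ennreal (x * ((phi_inv t)\<^sup>2 / mech (phi_inv t)))) at_top"
      using eventually_gt_at_top[of 0]
      by eventually_elim (use rescaled_integral_le_subcritical[OF x _ h h1] a in simp)
    show "eventually (\<lambda>t. rescaled_integral t x g \<le>
        ennreal b + ennreal (x * ((phi_inv t)\<^sup>2 / mech (phi_inv t)))) at_top"
      using eventually_gt_at_top[of 0]
      by eventually_elim (use rescaled_integral_le_subcritical[OF x _ g g1] b in simp)
  qed (fact err a b)+
  then show ?thesis by (simp add: a)
qed

end

section \<open>Weak and vague convergence\<close>

lemma measurable_ident_pos:
  assumes "sets N = sets (restrict_space borel {0<..})"
  shows "(\<lambda>y::real. y) \<in> N \<rightarrow>\<^sub>M borel"
  unfolding measurable_cong_sets[OF assms refl] by (rule measurable_restrict_space1) simp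

context cb_process
begin

lemma sets_trans_pos: "sets (trans_pos P Z t x) = sets (restrict_space borel {0<..})"
  unfolding trans_pos_def by (intro sets_restrict_space_cong) simp

lemma nn_integral_rescaled_trans_pos:
  assumes [measurable]: "g \<in> borel_measurable borel"
  shows "(\<integral>\<^sup>+y. g y \<partial>scale_measure (ennreal (1 / (x * mech (phi_inv t)))) (trans_pos P Z t x)) =
    rescaled_integral t x g"
proof -
  have g: "g \<in> borel_measurable (trans_pos P Z t x)"
    by (rule measurable_compose[OF measurable_ident_pos[OF sets_trans_pos] assms])
  have "(\<integral>\<^sup>+y. g y \<partial>trans_pos P Z t x) = alive_integral t x g"
    unfolding trans_pos_def alive_integral_def law_def
    by (rule nn_integral_restrict_space) simp
  then show ?thesis
    by (simp add: nn_integral_scale_measure[OF g] rescaled_integral_def)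
qed

end

text \<open>Reduces bounded signed test functions to functions with values in the unit interval and the
  constant \<open>1\<close>.\<close>

lemma integral_bounded_affine:
  fixes f :: "real \<Rightarrow> real"
  assumes "finite_measure N" "sets N = sets (restrict_space borel {0<..})"
    and f: "f \<in> borel_measurable borel" and B: "0 < B" "\<And>y. \<bar>f y\<bar> \<le> B"
  shows "(\<integral>y. f y \<partial>N) =
    2 * B * enn2real (\<integral>\<^sup>+y. ennreal ((f y + B) / (2 * B)) \<partial>N) - B * enn2real (\<integral>\<^sup>+y. 1 \<partial>N)"
proof -
  interpret finite_measure N by fact
  have meas: "f \<in> borel_measurable N"
    by (rule measurable_compose[OF measurable_ident_pos[OF assms(2)] f])
  have int: "integrable N f"
    by (rule integrable_const_bound[OF _ meas, of B]) (use B in auto)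
  have "enn2real (\<integral>\<^sup>+y. ennreal ((f y + B) / (2 * B)) \<partial>N) = (\<integral>y. (f y + B) / (2 * B) \<partial>N)"
  proof (intro integral_eq_nn_integral[symmetric] AE_I2 divide_nonneg_pos)
    show "0 \<le> f y + B" for y using B(2)[of y] by linarith
  qed (use B meas in auto)
  moreover have "enn2real (\<integral>\<^sup>+y. 1 \<partial>N) = measure N (space N)" by (simp add: measure_def)
  moreover have "(\<integral>y. (f y + B) / (2 * B) \<partial>N) = ((\<integral>y. f y \<partial>N) + B * measure N (space N)) / (2 * B)"
    using int by simp
  ultimately show ?thesis using B(1) by simp
qed

theorem cb_weak_conv:
  assumes "cb_process \<alpha> \<sigma> \<pi> M P Z u" and \<alpha>: "0 < \<alpha>"
    and yaglom: "yaglom_distribution \<alpha> (branching_mech \<alpha> \<sigma> \<pi>) \<nu>" and x: "0 < x"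
  shows "weak_conv_pos
    (\<lambda>t. scale_measure (ennreal (1 / (x * branching_mech \<alpha> \<sigma> \<pi> (ext_time_inv (branching_mech \<alpha> \<sigma> \<pi>) t))))
      (trans_pos P Z t x)) (scale_measure (ennreal (1 / \<alpha>)) \<nu>) at_top"
proof -
  interpret cb_process \<alpha> \<sigma> \<pi> M P Z u by fact
  have sets_nu: "sets \<nu> = sets (restrict_space borel {0<..})"
    and laplace_nu: "\<And>q. 0 < q \<Longrightarrow> (\<integral>y. exp (- q * y) \<partial>\<nu>) = 1 - exp (- \<alpha> * phi q)"
    using yaglom by (auto simp: yaglom_distribution_def)
  interpret nu: prob_space \<nu> using yaglom by (simp add: yaglom_distribution_def)
  have space_nu: "space \<nu> = {0<..}"
    using sets_eq_imp_space_eq[OF sets_nu] by (simp add: space_restrict_space)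
  define N where "N = scale_measure (ennreal (1 / \<alpha>)) \<nu>"
  define m where "m = distr N borel (\<lambda>y. y)"
  have sets_N: "sets N = sets (restrict_space borel {0<..})" by (simp add: N_def sets_nu)
  have meas_nu: "g \<in> borel_measurable \<nu>" if "g \<in> borel_measurable borel" for g :: "real \<Rightarrow> ennreal"
    by (rule measurable_compose[OF measurable_ident_pos[OF sets_nu] that])
  have int_N: "(\<integral>\<^sup>+y. g y \<partial>N) = ennreal (1 / \<alpha>) * (\<integral>\<^sup>+y. g y \<partial>\<nu>)"
    if "g \<in> borel_measurable borel" for g
    unfolding N_def by (rule nn_integral_scale_measure[OF meas_nu[OF that]])
  have int_m: "(\<integral>\<^sup>+y. g y \<partial>m) = (\<integral>\<^sup>+y. g y \<partial>N)" if "g \<in> borel_measurable borel" for g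
    unfolding m_def using that by (intro nn_integral_distr measurable_ident_pos[OF sets_N]) simp
  have mass: "emeasure N (space N) = ennreal (1 / \<alpha>)"
    using int_N[of "\<lambda>_. 1"] nu.emeasure_space_1 by simp
  interpret cb_limit_measure \<alpha> \<sigma> \<pi> M P Z u m
  proof
    show "sets m = sets borel" by (simp add: m_def)
    have "AE y in N. 0 < y"
      using space_nu by (intro AE_I2) (simp add: N_def space_scale_measure)
    then show "AE y in m. 0 < y"
      unfolding m_def by (subst AE_distr_iff[OF measurable_ident_pos[OF sets_N]]) auto
    fix q :: real assume q: "0 < q"
    have "(\<integral>\<^sup>+y. ennreal (exp (- q * y)) \<partial>\<nu>) = ennreal (\<integral>y. exp (- q * y) \<partial>\<nu>)"
    proof (rule nn_integral_eq_integral)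
      have "(\<lambda>y. exp (- q * y)) \<in> borel_measurable borel" by measurable
      then have "(\<lambda>y. exp (- q * y)) \<in> borel_measurable \<nu>"
        by (rule measurable_compose[OF measurable_ident_pos[OF sets_nu]])
      then show "integrable \<nu> (\<lambda>y. exp (- q * y))"
        using q by (intro nu.integrable_const_bound[where B=1] AE_I2) (auto simp: space_nu)
    qed simp
    then have "(\<integral>\<^sup>+y. ennreal (exp (- q * y)) \<partial>\<nu>) = ennreal (1 - exp (- \<alpha> * phi q))"
      by (simp only: laplace_nu[OF q])
    then have "(\<integral>\<^sup>+y. ennreal (exp (- q * y)) \<partial>m) = ennreal (1 / \<alpha>) * ennreal (1 - exp (- \<alpha> * phi q))"
      by (subst int_m, simp, subst int_N) simp_all
    then show "(\<integral>\<^sup>+y. ennreal (exp (- q * y)) \<partial>m) = ennreal (discounted_time \<alpha> (phi q))"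
      using \<alpha> by (simp add: discounted_time_def ennreal_mult'[symmetric])
  qed
  have mass_m: "emeasure m UNIV = ennreal (1 / \<alpha>)"
    using mass int_m[of "\<lambda>_. 1"] by (simp add: m_def)
  have fin_N: "finite_measure N" by (rule finite_measureI) (simp add: mass)
  have conv: "((\<lambda>t. \<integral>\<^sup>+y. h y \<partial>scale_measure (ennreal (1 / (x * mech (phi_inv t)))) (trans_pos P Z t x))
      \<longlongrightarrow> (\<integral>\<^sup>+y. h y \<partial>N)) at_top"
    if "h \<in> borel_measurable borel" "\<And>y. h y \<le> 1" for h
    using rescaled_integral_tendsto_subcritical[OF \<alpha> mass_m x that]
    by (simp add: nn_integral_rescaled_trans_pos[OF that(1)] int_m[OF that(1)])
  show ?thesis
    unfolding weak_conv_pos_def N_def[symmetric]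
  proof (intro allI impI)
    fix f :: "real \<Rightarrow> real"
    assume cont: "continuous_on {0<..} f" and bdd: "bounded (f ` {0<..})"
    let ?N = "\<lambda>t. scale_measure (ennreal (1 / (x * mech (phi_inv t)))) (trans_pos P Z t x)"
    obtain B where B: "0 < B" "\<And>y. 0 < y \<Longrightarrow> \<bar>f y\<bar> \<le> B"
      using bdd by (auto simp: bounded_pos)
    \<comment> \<open>The test function is only continuous on \<open>{0<..}\<close>; cutting it off there makes it Borel on the line.\<close>
    define f' where "f' y = indicator {0<..} y * f y" for y
    have f' [measurable]: "f' \<in> borel_measurable borel"
      using borel_measurable_continuous_on_indicator[OF _ cont] by (simp add: f'_def[abs_def])
    have B': "\<bar>f' y\<bar> \<le> B" for y using B by (auto simp: f'_def split: split_indicator)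
    define h where "h y = ennreal ((f' y + B) / (2 * B))" for y
    have h: "h \<in> borel_measurable borel" unfolding h_def by measurable
    have h1: "h y \<le> 1" for y
      using B'[of y] B(1) by (simp add: h_def abs_le_iff)
    have f_eq: "(\<integral>y. f y \<partial>L) = 2 * B * enn2real (\<integral>\<^sup>+y. h y \<partial>L) - B * enn2real (\<integral>\<^sup>+y. 1 \<partial>L)"
      if "finite_measure L" "sets L = sets (restrict_space borel {0<..})" for L
    proof -
      have "space L = {0<..}"
        using sets_eq_imp_space_eq[OF that(2)] by (simp add: space_restrict_space)
      then have "(\<integral>y. f y \<partial>L) = (\<integral>y. f' y \<partial>L)"
        by (intro Bochner_Integration.integral_cong) (simp_all add: f'_def)
      then show ?thesis
        using integral_bounded_affine[OF that f' B(1) B'] by (simp add: h_def)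
    qed
    have fin: "finite_measure (?N t)" if "0 < t" for t
    proof (rule finite_measureI)
      have "emeasure (?N t) (space (?N t)) = rescaled_integral t x (\<lambda>_. 1)"
        using nn_integral_rescaled_trans_pos[of "\<lambda>_. 1" x t] by simp
      also have "\<dots> < \<infinity>"
        using alive_integral_one[of x t] x that
        by (simp add: rescaled_integral_def ennreal_mult_less_top)
      finally show "emeasure (?N t) (space (?N t)) \<noteq> \<infinity>" by simp
    qed
    have enn2real: "((\<lambda>t. enn2real (I t)) \<longlongrightarrow> enn2real c) at_top"
      if "(I \<longlongrightarrow> c) at_top" "c < \<top>" for I :: "real \<Rightarrow> ennreal" and c
      using that by (intro tendsto_enn2real) simp_all
    have "((\<lambda>t. 2 * B * enn2real (\<integral>\<^sup>+y. h y \<partial>?N t) - B * enn2real (\<integral>\<^sup>+y. 1 \<partial>?N t)) \<longlongrightarrow>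
        2 * B * enn2real (\<integral>\<^sup>+y. h y \<partial>N) - B * enn2real (\<integral>\<^sup>+y. 1 \<partial>N)) at_top"
    proof (intro tendsto_diff tendsto_mult tendsto_const enn2real conv h h1)
      have "(\<integral>\<^sup>+y. h y \<partial>N) \<le> (\<integral>\<^sup>+y. 1 \<partial>N)" by (intro nn_integral_mono h1)
      then show "(\<integral>\<^sup>+y. h y \<partial>N) < \<top>" using mass by (auto intro: le_less_trans)
      show "(\<integral>\<^sup>+y. 1 \<partial>N) < \<top>" using mass by simp
    qed simp_all
    moreover have "eventually (\<lambda>t. 2 * B * enn2real (\<integral>\<^sup>+y. h y \<partial>?N t) - B * enn2real (\<integral>\<^sup>+y. 1 \<partial>?N t) =
        (\<integral>y. f y \<partial>?N t)) at_top"
      using eventually_gt_at_top[of 0]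
    proof eventually_elim
      case (elim t)
      show ?case by (rule f_eq[symmetric, OF fin[OF elim]]) (simp add: sets_trans_pos)
    qed
    ultimately show "((\<lambda>t. \<integral>y. f y \<partial>?N t) \<longlongrightarrow> (\<integral>y. f y \<partial>N)) at_top"
      unfolding f_eq[OF fin_N sets_N] by (rule Lim_transform_eventually)
  qed
qed

lemma nn_integral_exp_tail:
  fixes q y :: real
  assumes "0 < y"
  shows "(\<integral>\<^sup>+v. ennreal (exp (- v * y)) * indicator {q..} v \<partial>lborel) = ennreal (exp (- q * y) / y)"
proof -
  have "(\<integral>\<^sup>+v. ennreal (exp (- v * y)) * indicator {q..} v \<partial>lborel) = 0 - (- exp (- q * y) / y)"
  proof (rule nn_integral_FTC_atLeast)
    show "((\<lambda>v. - exp (- v * y) / y) has_real_derivative exp (- v * y)) (at v)" for v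
      using assms by (auto intro!: derivative_eq_intros)
    have "filterlim (\<lambda>v. y * v) at_top at_top"
      by (rule filterlim_tendsto_pos_mult_at_top[OF tendsto_const assms filterlim_ident])
    then have "filterlim (\<lambda>v. - v * y) at_bot at_top"
      by (simp add: filterlim_uminus_at_top mult.commute)
    then have "((\<lambda>v. exp (- v * y)) \<longlongrightarrow> 0) at_top"
      by (rule filterlim_compose[OF exp_at_bot])
    then have "((\<lambda>v. - exp (- v * y) / y) \<longlongrightarrow> - 0 / y) at_top"
      using assms by (intro tendsto_divide tendsto_minus tendsto_const) auto
    then show "((\<lambda>v. - exp (- v * y) / y) \<longlongrightarrow> 0) at_top" by simp
  qed auto
  then show ?thesis by simp
qed

context branching_mechanism
begin

lemma nn_integral_inverse_mech:
  assumes "0 < q"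
  shows "(\<integral>\<^sup>+v. ennreal (1 / mech v) * indicator {q..} v \<partial>lborel) = ennreal (phi q)"
proof -
  have int: "integrable lborel (\<lambda>v. indicator {q..} v * (1 / mech v))"
    using set_integrable_inverse_mech[OF assms] by (simp add: set_integrable_def)
  have "(\<integral>\<^sup>+v. ennreal (1 / mech v) * indicator {q..} v \<partial>lborel) =
      (\<integral>\<^sup>+v. ennreal (indicator {q..} v * (1 / mech v)) \<partial>lborel)"
    by (intro nn_integral_cong) (simp split: split_indicator)
  also have "\<dots> = ennreal (LBINT v:{q..}. 1 / mech v)"
    unfolding set_lebesgue_integral_def using int assms
    by (subst nn_integral_eq_integral) (auto intro!: AE_I2 mech_nonneg split: split_indicator)
  also have "(LBINT v:{q..}. 1 / mech v) = phi q"
    unfolding ext_time_def by (rule set_integral_discrete_difference[where X="{q}"]) auto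
  finally show ?thesis .
qed

text \<open>Integrating the transform of \<open>W\<close> over \<open>{q..}\<close> divides \<open>W\<close> by its argument.\<close>

lemma laplace_scale_fun_measure:
  assumes W: "scale_function mech W" and q: "0 < q"
  shows "(\<integral>\<^sup>+y. ennreal (exp (- q * y)) \<partial>scale_fun_measure W) = ennreal (phi q)"
proof -
  define W' where "W' y = indicator {0..} y * W y" for y
  have cont: "continuous_on {0..} W" and W0: "\<And>y. 0 \<le> y \<Longrightarrow> 0 \<le> W y"
    and int: "\<And>q. 0 < q \<Longrightarrow> set_integrable lborel {0..} (\<lambda>y. exp (- q * y) * W y)"
    and lap: "\<And>q. 0 < q \<Longrightarrow> (LBINT y:{0..}. exp (- q * y) * W y) = 1 / mech q"
    using W by (auto simp: scale_function_def)
  have [measurable]: "W' \<in> borel_measurable borel"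
    using borel_measurable_continuous_on_indicator[OF _ cont] by (simp add: W'_def[abs_def])
  have W'0: "0 \<le> W' y" for y using W0 by (simp add: W'_def split: split_indicator)
  have lap': "ennreal (1 / mech v) = (\<integral>\<^sup>+y. ennreal (exp (- v * y)) * ennreal (W' y) \<partial>lborel)" if "0 < v" for v
  proof -
    have i: "integrable lborel (\<lambda>y. exp (- v * y) * W' y)"
      using int[OF that] by (simp add: set_integrable_def W'_def mult.left_commute)
    have "(\<integral>\<^sup>+y. ennreal (exp (- v * y)) * ennreal (W' y) \<partial>lborel) = (\<integral>\<^sup>+y. ennreal (exp (- v * y) * W' y) \<partial>lborel)"
      by (simp add: ennreal_mult W'0)
    also have "\<dots> = ennreal (\<integral>y. exp (- v * y) * W' y \<partial>lborel)"
      using i by (rule nn_integral_eq_integral) (simp add: W'0)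
    also have "(\<integral>y. exp (- v * y) * W' y \<partial>lborel) = 1 / mech v"
      using lap[OF that] by (simp add: set_lebesgue_integral_def W'_def mult.left_commute)
    finally show ?thesis by simp
  qed
  have "ennreal (phi q) = (\<integral>\<^sup>+v. ennreal (1 / mech v) * indicator {q..} v \<partial>lborel)"
    by (rule nn_integral_inverse_mech[OF q, symmetric])
  also have "\<dots> = (\<integral>\<^sup>+v. \<integral>\<^sup>+y. ennreal (exp (- v * y)) * ennreal (W' y) * indicator {q..} v \<partial>lborel \<partial>lborel)"
  proof (rule nn_integral_cong)
    fix v :: real
    show "ennreal (1 / mech v) * indicator {q..} v =
        (\<integral>\<^sup>+y. ennreal (exp (- v * y)) * ennreal (W' y) * indicator {q..} v \<partial>lborel)"
      using lap'[of v] q by (cases "q \<le> v") (auto simp: nn_integral_multc)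
  qed
  also have "\<dots> = (\<integral>\<^sup>+y. \<integral>\<^sup>+v. ennreal (exp (- v * y)) * ennreal (W' y) * indicator {q..} v \<partial>lborel \<partial>lborel)"
    by (rule lborel_pair.Fubini') measurable
  also have "\<dots> = (\<integral>\<^sup>+y. ennreal (exp (- q * y)) * ennreal (W y / y) * indicator {0<..} y \<partial>lborel)"
  proof (rule nn_integral_cong_AE)
    show "AE y in lborel. (\<integral>\<^sup>+v. ennreal (exp (- v * y)) * ennreal (W' y) * indicator {q..} v \<partial>lborel) =
        ennreal (exp (- q * y)) * ennreal (W y / y) * indicator {0<..} y"
      using AE_lborel_singleton[of 0]
    proof eventually_elim
      case (elim y)
      show ?case
      proof (cases "0 < y")
        case True
        have "(\<integral>\<^sup>+v. ennreal (exp (- v * y)) * ennreal (W' y) * indicator {q..} v \<partial>lborel) =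
            (\<integral>\<^sup>+v. ennreal (W' y) * (ennreal (exp (- v * y)) * indicator {q..} v) \<partial>lborel)"
          by (simp add: ac_simps)
        also have "\<dots> = ennreal (W' y) * ennreal (exp (- q * y) / y)"
          by (subst nn_integral_cmult) (simp_all add: nn_integral_exp_tail[OF True, simplified])
        also have "\<dots> = ennreal (exp (- q * y)) * ennreal (W y / y)"
          using True W0[of y] by (simp add: W'_def ennreal_mult[symmetric])
        finally show ?thesis using True by simp
      qed (use elim in \<open>simp add: W'_def\<close>)
    qed
  qed
  also have "\<dots> = (\<integral>\<^sup>+y. ennreal (exp (- q * y)) \<partial>scale_fun_measure W)"
  proof -
    have "(\<lambda>y. W' y / y) \<in> borel_measurable (restrict_space lborel {0<..})"
      by (intro measurable_restrict_space1) measurable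
    then have "(\<lambda>y. W y / y) \<in> borel_measurable (restrict_space lborel {0<..})"
      by (rule measurable_cong[THEN iffD1, rotated]) (simp add: W'_def space_restrict_space)
    then have "(\<lambda>y. ennreal (W y / y)) \<in> borel_measurable (restrict_space lborel {0<..})"
      by (rule measurable_compose[OF _ measurable_ennreal])
    moreover have "(\<lambda>y. ennreal (exp (- q * y))) \<in> borel_measurable (restrict_space lborel {0<..})"
      by (intro measurable_restrict_space1) measurable
    ultimately have "(\<integral>\<^sup>+y. ennreal (exp (- q * y)) \<partial>scale_fun_measure W) =
        (\<integral>\<^sup>+y. ennreal (W y / y) * ennreal (exp (- q * y)) \<partial>restrict_space lborel {0<..})"
      unfolding scale_fun_measure_def by (rule nn_integral_density)
    also have "\<dots> = (\<integral>\<^sup>+y. ennreal (W y / y) * ennreal (exp (- q * y)) * indicator {0<..} y \<partial>lborel)"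
      by (rule nn_integral_restrict_space) simp
    finally show ?thesis by (simp add: ac_simps)
  qed
  finally show ?thesis by simp
qed

end

theorem cb_vague_conv:
  assumes "cb_process \<alpha> \<sigma> \<pi> M P Z u" and \<alpha>: "\<alpha> = 0"
    and W: "scale_function (branching_mech \<alpha> \<sigma> \<pi>) W" and x: "0 < x"
  shows "vague_conv_pos
    (\<lambda>t. scale_measure (ennreal (1 / (x * branching_mech \<alpha> \<sigma> \<pi> (ext_time_inv (branching_mech \<alpha> \<sigma> \<pi>) t))))
      (trans_pos P Z t x)) (scale_fun_measure W) at_top"
proof -
  interpret cb_process \<alpha> \<sigma> \<pi> M P Z u by fact
  define N where "N = scale_fun_measure W"
  have sets_N: "sets N = sets (restrict_space borel {0<..})"
    unfolding N_def scale_fun_measure_def sets_density by (intro sets_restrict_space_cong) simp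
  have space_N: "space N = {0<..}"
    using sets_eq_imp_space_eq[OF sets_N] by (simp add: space_restrict_space)
  define m where "m = distr N borel (\<lambda>y. y)"
  have int_m: "(\<integral>\<^sup>+y. g y \<partial>m) = (\<integral>\<^sup>+y. g y \<partial>N)" if "g \<in> borel_measurable borel" for g
    unfolding m_def using that by (intro nn_integral_distr measurable_ident_pos[OF sets_N]) simp
  interpret cb_limit_measure \<alpha> \<sigma> \<pi> M P Z u m
  proof
    show "sets m = sets borel" by (simp add: m_def)
    have "AE y in N. 0 < y" using space_N by (intro AE_I2) simp
    then show "AE y in m. 0 < y"
      unfolding m_def by (subst AE_distr_iff[OF measurable_ident_pos[OF sets_N]]) auto
    fix q :: real assume q: "0 < q"
    show "(\<integral>\<^sup>+y. ennreal (exp (- q * y)) \<partial>m) = ennreal (discounted_time \<alpha> (phi q))"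
      using laplace_scale_fun_measure[OF W q] \<alpha> by (subst int_m) (simp_all add: N_def discounted_time_def)
  qed
  let ?N = "\<lambda>t. scale_measure (ennreal (1 / (x * mech (phi_inv t)))) (trans_pos P Z t x)"
  have int_ext: "(\<integral>\<^sup>+y. ennreal (g y) \<partial>extend_zero L) = (\<integral>\<^sup>+y. ennreal (indicator {0..} y * g y) \<partial>L)"
    if L: "sets L = sets (restrict_space borel {0<..})" and g: "continuous_on {0..} g" for L g
  proof -
    have space: "space L = {0<..}"
      using sets_eq_imp_space_eq[OF L] by (simp add: space_restrict_space)
    have "(\<lambda>y. y) \<in> L \<rightarrow>\<^sub>M restrict_space borel {0..}"
      using measurable_ident_pos[OF L] by (intro measurable_restrict_space2) (auto simp: space)
    moreover have "g \<in> borel_measurable (restrict_space borel {0..})"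
      using g by (rule borel_measurable_continuous_on_restrict)
    ultimately have "(\<integral>\<^sup>+y. ennreal (g y) \<partial>extend_zero L) = (\<integral>\<^sup>+y. ennreal (g y) \<partial>L)"
      unfolding extend_zero_def by (intro nn_integral_distr measurable_compose[OF _ measurable_ennreal]) simp_all
    also have "\<dots> = (\<integral>\<^sup>+y. ennreal (indicator {0..} y * g y) \<partial>L)"
      by (intro nn_integral_cong) (simp add: space)
    finally show ?thesis .
  qed
  have conv: "((\<lambda>t. \<integral>\<^sup>+y. ennreal (g y) \<partial>extend_zero (?N t)) \<longlongrightarrow> (\<integral>\<^sup>+y. ennreal (g y) \<partial>extend_zero N)) at_top"
    if g: "continuous_on {0..} g" for g
  proof -
    define g' where "g' y = ennreal (indicator {0..} y * g y)" for y
    have "(\<lambda>y. indicator {0..} y * g y) \<in> borel_measurable borel"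
      using borel_measurable_continuous_on_indicator[OF _ g] by simp
    then have g': "g' \<in> borel_measurable borel"
      unfolding g'_def by (rule measurable_compose[OF _ measurable_ennreal])
    have "(\<integral>\<^sup>+y. ennreal (g y) \<partial>extend_zero (?N t)) = rescaled_integral t x g'" for t
      using int_ext[of "?N t", OF _ g] nn_integral_rescaled_trans_pos[OF g', of x t]
      by (simp add: sets_trans_pos g'_def)
    moreover have "(\<integral>\<^sup>+y. ennreal (g y) \<partial>extend_zero N) = (\<integral>\<^sup>+y. g' y \<partial>m)"
      using int_ext[OF sets_N g] int_m[OF g'] by (simp add: g'_def)
    ultimately show ?thesis
      using rescaled_integral_tendsto_critical[OF \<alpha> x g'] by simp
  qed
  show ?thesis
    unfolding vague_conv_pos_def N_def[symmetric]
  proof (intro allI impI)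
    fix g :: "real \<Rightarrow> real"
    assume g: "continuous_on {0..} g" and ex: "integral_exists (extend_zero N) g"
    have g': "continuous_on {0..} (\<lambda>y. - g y)" using g by (intro continuous_on_minus)
    show "((\<lambda>t. ereal_integral (extend_zero (?N t)) g) \<longlongrightarrow> ereal_integral (extend_zero N) g) at_top"
      unfolding ereal_integral_def
    proof (rule tendsto_diff_ereal_general[OF tendsto_enn2erealI[OF conv[OF g]] tendsto_enn2erealI[OF conv[OF g']]])
      have "enn2ereal c \<noteq> - \<infinity>" for c
      proof
        assume "enn2ereal c = - \<infinity>"
        with enn2ereal_nonneg[of c] show False by simp
      qed
      moreover have "enn2ereal c \<noteq> \<infinity>" if "c < \<infinity>" for c
        using that by (cases c rule: ennreal_cases) simp_all
      ultimately show "\<not> (enn2ereal (\<integral>\<^sup>+y. ennreal (g y) \<partial>extend_zero N) = \<infinity> \<and>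
            enn2ereal (\<integral>\<^sup>+y. ennreal (- g y) \<partial>extend_zero N) = \<infinity> \<or>
          enn2ereal (\<integral>\<^sup>+y. ennreal (g y) \<partial>extend_zero N) = - \<infinity> \<and>
            enn2ereal (\<integral>\<^sup>+y. ennreal (- g y) \<partial>extend_zero N) = - \<infinity>)"
        using ex unfolding integral_exists_def by blast
    qed
  qed
qed

theorem theorem3p2:
  fixes \<alpha> \<sigma> :: real and \<pi> :: "real measure"
    and M :: "'w measure" and P :: "real \<Rightarrow> 'w measure"
    and Z :: "real \<Rightarrow> 'w \<Rightarrow> real" and u :: "real \<Rightarrow> real \<Rightarrow> real"
    and \<psi> \<phi>inv :: "real \<Rightarrow> real"
  assumes cb: "cb_process \<alpha> \<sigma> \<pi> M P Z u"
  defines "\<psi> \<equiv> branching_mech \<alpha> \<sigma> \<pi>"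
    and "\<phi>inv \<equiv> ext_time_inv \<psi>"
  shows "(\<alpha> > 0 \<longrightarrow> (\<forall>\<nu>. yaglom_distribution \<alpha> \<psi> \<nu> \<longrightarrow>
            (\<forall>x>0. weak_conv_pos
               (\<lambda>t. scale_measure (ennreal (1 / (x * \<psi> (\<phi>inv t)))) (trans_pos P Z t x))
               (scale_measure (ennreal (1 / \<alpha>)) \<nu>) at_top))) \<and>
         (\<alpha> = 0 \<longrightarrow> (\<forall>W. scale_function \<psi> W \<longrightarrow>
            (\<forall>x>0. vague_conv_pos
               (\<lambda>t. scale_measure (ennreal (1 / (x * \<psi> (\<phi>inv t)))) (trans_pos P Z t x))
               (scale_fun_measure W) at_top)))"
  unfolding \<psi>_def \<phi>inv_def
proof (intro conjI impI allI)
  fix \<nu> and x :: real assume "0 < \<alpha>" "yaglom_distribution \<alpha> (branching_mech \<alpha> \<sigma> \<pi>) \<nu>" "0 < x"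
  then show "weak_conv_pos
      (\<lambda>t. scale_measure (ennreal (1 / (x * branching_mech \<alpha> \<sigma> \<pi> (ext_time_inv (branching_mech \<alpha> \<sigma> \<pi>) t))))
        (trans_pos P Z t x)) (scale_measure (ennreal (1 / \<alpha>)) \<nu>) at_top"
    by (rule cb_weak_conv[OF cb])
next
  fix W and x :: real assume "\<alpha> = 0" "scale_function (branching_mech \<alpha> \<sigma> \<pi>) W" "0 < x"
  then show "vague_conv_pos
      (\<lambda>t. scale_measure (ennreal (1 / (x * branching_mech \<alpha> \<sigma> \<pi> (ext_time_inv (branching_mech \<alpha> \<sigma> \<pi>) t))))
        (trans_pos P Z t x)) (scale_fun_measure W) at_top"
    by (rule cb_vague_conv[OF cb])
qed

end
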